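(* For every real number $p>1$ that is not an even integer, there exists a positive integer $n$ such that the pair $(D_n,p)$ is not rate-monotonic, where $D_n$ is the dihedral group of order $2n$. Explicitly: there exist a positive integer $n$, symmetric generating rate collections $\boldsymbol{\lambda}\le\boldsymbol{\lambda}'$ in $\mathbb{R}_{\ge 0}^{D_n}$, and a real $t\ge 0$ such that $d_p^{\boldsymbol{\lambda}}(t)<d_p^{\boldsymbol{\lambda}'}(t)$.
   Context: $D_n=\langle r,b\mid r^n=b^2=e,\ brb=r^{-1}\rangle$ is the dihedral group of order $2n$. Let $G$ be a finite group with identity $e$. A rate collection is $\boldsymbol{\lambda}=(\lambda_s)_{s\in G}\in\mathbb{R}_{\ge 0}^G$. It is symmetric if $\lambda_s=\lambda_{s^{-1}}$ for all $s\in G$, and generating if its support $\{s\in G:\lambda_s>0\}$ generates $G$. Write $\boldsymbol{\lambda}\le\boldsymbol{\lambda}'$ if $\lambda_s\le\lambda'_s$ for all $s\in G$. The continuous-time random walk $(X_t^{\boldsymbol{\lambda}})_{t\ge 0}$ on $G$ driven by $\boldsymbol{\lambda}$ starts at $e$ at time $0$. Each $s\in G$ has an independent Poisson clock of rate $\lambda_s$, and whenever the clock of $s$ rings, the current state is multiplied by $s$ on the right (so it is the continuous-time Markov chain with jump rate $\lambda_s$ from $g$ to $gs$). Let $P_t^{\boldsymbol{\lambda}}(g)=\mathbb{P}(X_t^{\boldsymbol{\lambda}}=g)$. For $1\le p<\infty$, let $$d_p^{\boldsymbol{\lambda}}(t)=\Bigl(\sum_{g\in G}\bigl|P_t^{\boldsymbol{\lambda}}(g)-\tfrac{1}{|G|}\bigr|^p\Bigr)^{1/p}.$$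 The pair $(G,p)$ is rate-monotonic if for all symmetric generating $\boldsymbol{\lambda},\boldsymbol{\lambda}'\in\mathbb{R}_{\ge 0}^G$ with $\boldsymbol{\lambda}\le\boldsymbol{\lambda}'$, one has $d_p^{\boldsymbol{\lambda}}(t)\ge d_p^{\boldsymbol{\lambda}'}(t)$ for all real $t\ge 0$. *)

theory Defs
  imports "HOL-Probability.Probability" "HOL-Algebra.Generated_Groups"
begin

section \<open>Rate collections\<close>

definition rate_collection :: "('a, 'b) monoid_scheme \<Rightarrow> ('a \<Rightarrow> real) \<Rightarrow> bool" where
  "rate_collection G rate \<longleftrightarrow> (\<forall>s\<in>carrier G. 0 \<le> rate s)"

definition rate_support :: "('a, 'b) monoid_scheme \<Rightarrow> ('a \<Rightarrow> real) \<Rightarrow> 'a set" where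
  "rate_support G rate = {s \<in> carrier G. 0 < rate s}"

definition symmetric_rates :: "('a, 'b) monoid_scheme \<Rightarrow> ('a \<Rightarrow> real) \<Rightarrow> bool" where
  "symmetric_rates G rate \<longleftrightarrow> (\<forall>s\<in>carrier G. rate s = rate (inv\<^bsub>G\<^esub> s))"

definition generating_rates :: "('a, 'b) monoid_scheme \<Rightarrow> ('a \<Rightarrow> real) \<Rightarrow> bool" where
  "generating_rates G rate \<longleftrightarrow> generate G (rate_support G rate) = carrier G"

definition rates_le :: "('a, 'b) monoid_scheme \<Rightarrow> ('a \<Rightarrow> real) \<Rightarrow> ('a \<Rightarrow> real) \<Rightarrow> bool" where
  "rates_le G rate rate' \<longleftrightarrow> (\<forall>s\<in>carrier G. rate s \<le> rate' s)"


section \<open>The continuous-time random walk driven by Poisson clocks\<close>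

text \<open>
  A sample point assigns to every clock \<open>s\<close> of positive rate its successive waiting times
  \<open>\<omega> (s, 0), \<omega> (s, 1), \<dots>\<close>; all of them are independent, and those of \<open>s\<close> are exponential of
  parameter \<open>rate s\<close>. A clock of rate \<open>0\<close> never rings and is left out.
\<close>

definition clock_space ::
    "('a, 'b) monoid_scheme \<Rightarrow> ('a \<Rightarrow> real) \<Rightarrow> ('a \<times> nat \<Rightarrow> real) measure" where
  "clock_space G rate =
     Pi\<^sub>M (rate_support G rate \<times> UNIV) (\<lambda>(s, i). density lborel (exponential_density (rate s)))"

definition ring_time :: "('a \<times> nat \<Rightarrow> real) \<Rightarrow> 'a \<times> nat \<Rightarrow> real" where
  "ring_time \<omega> = (\<lambda>(s, k). \<Sum>i\<le>k. \<omega> (s, i))"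

text \<open>
  The rings up to time \<open>t\<close> in chronological order. Such a list is unique; it exists unless two
  rings are simultaneous or there are infinitely many of them before \<open>t\<close>, which has probability
  \<open>0\<close>. On that null set the value is a constant, so measurability is not affected.
\<close>

definition rings_upto ::
    "('a, 'b) monoid_scheme \<Rightarrow> ('a \<Rightarrow> real) \<Rightarrow> real \<Rightarrow> ('a \<times> nat \<Rightarrow> real) \<Rightarrow> ('a \<times> nat) list" where
  "rings_upto G rate t \<omega> =
     (THE xs. set xs = {x \<in> rate_support G rate \<times> UNIV. ring_time \<omega> x \<le> t} \<and>
              sorted_wrt (\<lambda>x y. ring_time \<omega> x < ring_time \<omega> y) xs)"

definition random_walk ::
    "('a, 'b) monoid_scheme \<Rightarrow> ('a \<Rightarrow> real) \<Rightarrow> real \<Rightarrow> ('a \<times> nat \<Rightarrow> real) \<Rightarrow> 'a" where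
  "random_walk G rate t \<omega> =
     foldl (\<lambda>g s. g \<otimes>\<^bsub>G\<^esub> s) \<one>\<^bsub>G\<^esub> (map fst (rings_upto G rate t \<omega>))"

definition walk_prob :: "('a, 'b) monoid_scheme \<Rightarrow> ('a \<Rightarrow> real) \<Rightarrow> real \<Rightarrow> 'a \<Rightarrow> real" where
  "walk_prob G rate t g =
     measure (clock_space G rate) {\<omega> \<in> space (clock_space G rate). random_walk G rate t \<omega> = g}"

definition lp_distance :: "('a, 'b) monoid_scheme \<Rightarrow> ('a \<Rightarrow> real) \<Rightarrow> real \<Rightarrow> real \<Rightarrow> real" where
  "lp_distance G rate p t =
     (\<Sum>g\<in>carrier G. \<bar>walk_prob G rate t g - 1 / real (order G)\<bar> powr p) powr (1 / p)"

definition rate_monotonic :: "('a, 'b) monoid_scheme \<Rightarrow> real \<Rightarrow> bool" where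
  "rate_monotonic G p \<longleftrightarrow>
     (\<forall>rate rate'.
        rate_collection G rate \<and> symmetric_rates G rate \<and> generating_rates G rate \<and>
        rate_collection G rate' \<and> symmetric_rates G rate' \<and> generating_rates G rate' \<and>
        rates_le G rate rate' \<longrightarrow>
        (\<forall>t\<ge>0. lp_distance G rate p t \<ge> lp_distance G rate' p t))"


section \<open>Dihedral groups\<close>

text \<open>
  The pair \<open>(i, a)\<close> stands for \<open>r\<^sup>i\<close> if \<open>a\<close> is false and for \<open>r\<^sup>i b\<close> if \<open>a\<close> is true; the
  multiplication rule is \<open>b r\<^sup>j = r\<^sup>-\<^sup>j b\<close>. The parameter \<open>n\<close> is meant to be positive; the cases
  \<open>n = 1, 2\<close> give the cyclic group of order 2 and the Klein four-group.
\<close>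

definition dihedral :: "nat \<Rightarrow> (int \<times> bool) monoid" where
  "dihedral n =
     \<lparr>carrier = {0..<int n} \<times> UNIV,
      mult = (\<lambda>(i, a) (j, c). ((if a then i - j else i + j) mod int n, a \<noteq> c)),
      one = (0, False)\<rparr>"

definition dihedral_r :: "nat \<Rightarrow> int \<times> bool" where
  "dihedral_r n = (1 mod int n, False)"

definition dihedral_b :: "int \<times> bool" where
  "dihedral_b = (0, True)"

lemma group_dihedral:
  assumes "0 < n"
  shows "group (dihedral n)"
proof (rule groupI)
  fix x y z
  assume "x \<in> carrier (dihedral n)" "y \<in> carrier (dihedral n)" "z \<in> carrier (dihedral n)"
  then show "x \<otimes>\<^bsub>dihedral n\<^esub> y \<otimes>\<^bsub>dihedral n\<^esub> z = x \<otimes>\<^bsub>dihedral n\<^esub> (y \<otimes>\<^bsub>dihedral n\<^esub> z)"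
    by (auto simp: dihedral_def mod_simps algebra_simps split: if_splits)
next
  fix x
  assume x: "x \<in> carrier (dihedral n)"
  obtain i a where [simp]: "x = (i, a)" by (cases x)
  show "\<exists>y\<in>carrier (dihedral n). y \<otimes>\<^bsub>dihedral n\<^esub> x = \<one>\<^bsub>dihedral n\<^esub>"
    using x assms
    by (intro bexI[of _ "(if a then i else (- i) mod int n, a)"])
       (auto simp: dihedral_def mod_simps)
qed (use assms in \<open>auto simp: dihedral_def\<close>)

lemma order_dihedral: "order (dihedral n) = 2 * n"
  by (simp add: order_def dihedral_def card_cartesian_product)

lemma dihedral_r_pow: "dihedral_r n [^]\<^bsub>dihedral n\<^esub> (k::nat) = (int k mod int n, False)"
  by (induction k) (auto simp: dihedral_def dihedral_r_def nat_pow_def mod_simps ac_simps)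

lemma dihedral_relations:
  assumes "0 < n"
  shows "dihedral_r n [^]\<^bsub>dihedral n\<^esub> n = \<one>\<^bsub>dihedral n\<^esub>"
    and "dihedral_b \<otimes>\<^bsub>dihedral n\<^esub> dihedral_b = \<one>\<^bsub>dihedral n\<^esub>"
    and "dihedral_b \<otimes>\<^bsub>dihedral n\<^esub> dihedral_r n \<otimes>\<^bsub>dihedral n\<^esub> dihedral_b
         = inv\<^bsub>dihedral n\<^esub> (dihedral_r n)"
proof -
  show "dihedral_r n [^]\<^bsub>dihedral n\<^esub> n = \<one>\<^bsub>dihedral n\<^esub>"
    unfolding dihedral_r_pow by (simp add: dihedral_def)
  show "dihedral_b \<otimes>\<^bsub>dihedral n\<^esub> dihedral_b = \<one>\<^bsub>dihedral n\<^esub>"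
    by (simp add: dihedral_b_def dihedral_def)
  interpret group "dihedral n" using assms by (rule group_dihedral)
  show "dihedral_b \<otimes>\<^bsub>dihedral n\<^esub> dihedral_r n \<otimes>\<^bsub>dihedral n\<^esub> dihedral_b
         = inv\<^bsub>dihedral n\<^esub> (dihedral_r n)"
    using assms
    by (intro inv_equality[symmetric])
       (auto simp: dihedral_b_def dihedral_r_def dihedral_def mod_simps)
qed

lemma dihedral_generated:
  assumes "0 < n"
  shows "generate (dihedral n) {dihedral_r n, dihedral_b} = carrier (dihedral n)"
proof
  interpret group "dihedral n" using assms by (rule group_dihedral)
  have sub: "{dihedral_r n, dihedral_b} \<subseteq> carrier (dihedral n)"
    using assms by (auto simp: dihedral_r_def dihedral_b_def dihedral_def)
  then show "generate (dihedral n) {dihedral_r n, dihedral_b} \<subseteq> carrier (dihedral n)"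
    by (rule generate_incl)
  have pow: "dihedral_r n [^]\<^bsub>dihedral n\<^esub> (k::nat)
      \<in> generate (dihedral n) {dihedral_r n, dihedral_b}" for k
    by (induction k) (auto simp: nat_pow_Suc intro: generate.intros)
  show "carrier (dihedral n) \<subseteq> generate (dihedral n) {dihedral_r n, dihedral_b}"
  proof
    fix x assume x: "x \<in> carrier (dihedral n)"
    obtain i a where ia: "x = (i, a)" by (cases x)
    with x have i: "0 \<le> i" "i < int n" by (auto simp: dihedral_def)
    have r: "(i, False) \<in> generate (dihedral n) {dihedral_r n, dihedral_b}"
      using pow[of "nat i"] i by (simp add: dihedral_r_pow)
    have "(i, False) \<otimes>\<^bsub>dihedral n\<^esub> dihedral_b \<in> generate (dihedral n) {dihedral_r n, dihedral_b}"
      by (intro generate.eng r generate.incl) auto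
    then have "(i, True) \<in> generate (dihedral n) {dihedral_r n, dihedral_b}"
      using i by (simp add: dihedral_def dihedral_b_def)
    with r show "x \<in> generate (dihedral n) {dihedral_r n, dihedral_b}"
      by (cases a) (auto simp: ia)
  qed
qed

end

theory Submission
  imports Defs "HOL-Real_Asymp.Real_Asymp"
begin

text \<open>
  If only reflections \<open>r\<^sup>x b\<close> carry rates, with values \<open>l x\<close>, sum \<open>B\<close> and Fourier transform \<open>\<gamma>\<close> on
  \<open>\<int>/n\<close>, then at time \<open>1\<close> the walk has Fourier transform \<open>exp (-B) cosh \<bar>\<gamma>\<bar>\<close> on the rotations and
  \<open>exp (-B) sinh \<bar>\<gamma>\<bar> sgn \<gamma>\<close> on the reflections. Let \<open>\<gamma> = s\<close> at \<open>\<plusminus> 1\<close>, \<open>\<gamma> = \<plusminus> \<i> (s - \<kappa>)\<close> at \<open>\<plusminus> j\<close>, and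
  \<open>\<gamma> = 0\<close> at the other nontrivial frequencies. As \<open>s\<close> tends to infinity, the rescaled deviation from
  uniform converges to \<open>cos \<theta> + \<eta> cos (j \<theta>)\<close> on the rotations and \<open>cos \<theta> + \<eta> sin (j \<theta>)\<close> on the
  reflections, where \<open>\<eta> = exp (-\<kappa>)\<close>. Raising the rate of \<open>b\<close> by \<open>s\<close> leaves the scaling unchanged and
  kills the modes \<open>\<plusminus> j\<close>, so that the limit becomes \<open>cos \<theta>\<close> on both cosets. For small \<open>\<eta>\<close> the latter
  has the larger \<open>p\<close>-norm as soon as the \<open>j\<close>-th cosine coefficient of \<open>\<bar>cos \<theta>\<bar>\<^sup>p\<^sup>-\<^sup>1 sgn (cos \<theta>)\<close> is
  negative. A two-term recursion in \<open>j\<close> shows that some coefficient is negative unless \<open>p\<close> is an even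
  integer, and this passes to the sums over \<open>\<int>/n\<close> for large \<open>n\<close>. The walk itself is computed by
  summing over the words that the clocks spell out until time \<open>1\<close>.
\<close>

section \<open>The chronological word of the clocks\<close>

locale poisson_clocks =
  fixes S :: "'a set" and r :: "'a \<Rightarrow> real"
  assumes finite_S: "finite S" and rate_pos: "\<And>s. 0 < r s"
begin

abbreviation "wtime \<equiv> (\<lambda>x::'a \<times> nat. density lborel (exponential_density (r (fst x))))"

abbreviation "clocks \<equiv> Pi\<^sub>M (S \<times> UNIV) wtime"

sublocale product_prob_space wtime "S \<times> UNIV"
proof -
  have "prob_space (wtime x)" for x by (intro prob_space_exponential_density rate_pos)
  then show "product_prob_space wtime"
    by (intro product_prob_space.intro product_sigma_finite.intro product_prob_space_axioms.intro prob_space_imp_sigma_finite)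
qed

lemma wait_component [measurable]: "x \<in> S \<times> UNIV \<Longrightarrow> (\<lambda>\<omega>. \<omega> x) \<in> borel_measurable clocks"
  using measurable_component_singleton[of x "S \<times> UNIV" wtime] by simp

text \<open>Memorylessness of one exponential clock: after the substitution y = \<tau> + z the
  density splits off the factor \<open>exp (- \<tau> * r (fst x))\<close>, the probability of
  waiting longer than \<tau>.\<close>

lemma emeasure_wait_shift:
  assumes "0 \<le> \<tau>" "A \<in> sets borel"
  shows "emeasure (wtime x) {y. \<tau> < y \<and> y - \<tau> \<in> A} = ennreal (exp (- \<tau> * r (fst x))) * emeasure (wtime x) A"
proof -
  note [measurable] = assms(2)
  let ?l = "r (fst x)"
  have "emeasure (wtime x) {y. \<tau> < y \<and> y - \<tau> \<in> A}
      = (\<integral>\<^sup>+ y. ennreal (exponential_density ?l y) * indicator {y. \<tau> < y \<and> y - \<tau> \<in> A} y \<partial>lborel)"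
    by (subst emeasure_density) auto
  also have "\<dots> = (\<integral>\<^sup>+ z. ennreal (exponential_density ?l (\<tau> + 1 * z))
      * indicator {y. \<tau> < y \<and> y - \<tau> \<in> A} (\<tau> + 1 * z) \<partial>lborel)"
    by (subst nn_integral_real_affine[where c = 1 and t = \<tau>]) auto
  also have "\<dots> = (\<integral>\<^sup>+ z. ennreal (exp (- \<tau> * ?l)) * (ennreal (exponential_density ?l z) * indicator A z) \<partial>lborel)"
  proof (rule nn_integral_cong_AE)
    \<comment> \<open>At z = 0 the strict inequality fails while the exponential density is
      positive, so the integrands may differ there and agree only almost everywhere.\<close>
    have "AE z in lborel. z \<noteq> (0::real)" by (rule AE_lborel_singleton)
    then show "AE z in lborel. ennreal (exponential_density ?l (\<tau> + 1 * z))
        * indicator {y. \<tau> < y \<and> y - \<tau> \<in> A} (\<tau> + 1 * z)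
        = ennreal (exp (- \<tau> * ?l)) * (ennreal (exponential_density ?l z) * indicator A z)"
    proof eventually_elim
      case (elim z)
      show ?case
      proof (cases "z < 0")
        case True
        then show ?thesis by (simp add: exponential_density_def)
      next
        case False
        with elim have "z > 0" by simp
        then show ?thesis using assms(1)
          by (auto simp: exponential_density_def indicator_def ennreal_mult'[symmetric] rate_pos less_imp_le
              exp_add[symmetric] algebra_simps)
      qed
    qed
  qed
  also have "\<dots> = ennreal (exp (- \<tau> * ?l)) * emeasure (wtime x) A"
    by (subst nn_integral_cmult) (auto simp: emeasure_density)
  finally show ?thesis .
qed

text \<open>The clocks seen from time \<tau>, when \<open>s\<close> rings: the pending first waits
  of the other clocks lose \<tau>, while \<open>s\<close> itself is handled by
  \<open>drop_first\<close>.\<close>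

definition elapse :: "'a \<Rightarrow> real \<Rightarrow> ('a \<times> nat \<Rightarrow> real) \<Rightarrow> 'a \<times> nat \<Rightarrow> real" where
  "elapse s \<tau> \<omega> = (\<lambda>x\<in>S \<times> UNIV. if fst x \<noteq> s \<and> snd x = 0 then \<omega> x - \<tau> else \<omega> x)"

definition drop_first :: "'a \<Rightarrow> ('a \<times> nat \<Rightarrow> real) \<Rightarrow> 'a \<times> nat \<Rightarrow> real" where
  "drop_first s \<omega> = (\<lambda>x\<in>S \<times> UNIV. if fst x = s then \<omega> (s, Suc (snd x)) else \<omega> x)"

text \<open>A right inverse of \<open>drop_first s\<close> with prescribed first wait \<tau>; it
  describes a sample point by the first wait of \<open>s\<close> and a fresh family of
  clocks.\<close>

definition insert_first :: "'a \<Rightarrow> real \<Rightarrow> ('a \<times> nat \<Rightarrow> real) \<Rightarrow> 'a \<times> nat \<Rightarrow> real" where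
  "insert_first s \<tau> \<omega> = (\<lambda>x\<in>S \<times> UNIV. if fst x = s then (case snd x of 0 \<Rightarrow> \<tau> | Suc i \<Rightarrow> \<omega> (s, i)) else \<omega> x)"

lemma measurable_elapse [measurable]:
  "(\<lambda>(\<tau>, \<omega>). elapse s \<tau> \<omega>) \<in> borel \<Otimes>\<^sub>M clocks \<rightarrow>\<^sub>M clocks"
  unfolding elapse_def split_beta'
proof (rule measurable_restrict)
  fix x assume [measurable]: "x \<in> S \<times> (UNIV :: nat set)"
  show "(\<lambda>z. if fst x \<noteq> s \<and> snd x = 0 then snd z x - fst z else snd z x) \<in> borel \<Otimes>\<^sub>M clocks \<rightarrow>\<^sub>M wtime x"
    by (auto simp: measurable_density_eq1 cong: measurable_cong_sets)
qed

lemma measurable_drop_first [measurable]: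
  assumes "s \<in> S"
  shows "drop_first s \<in> clocks \<rightarrow>\<^sub>M clocks"
  unfolding drop_first_def
proof (rule measurable_restrict)
  fix x assume [measurable]: "x \<in> S \<times> (UNIV :: nat set)"
  have [measurable]: "(s, Suc (snd x)) \<in> S \<times> UNIV" using assms by simp
  show "(\<lambda>z. if fst x = s then z (s, Suc (snd x)) else z x) \<in> clocks \<rightarrow>\<^sub>M wtime x"
    by (auto cong: measurable_cong_sets)
qed

text \<open>Given that no clock other than \<open>s\<close> rings up to \<tau>, the clocks reduced
  by \<tau> are distributed as fresh ones. Both sides are finite measures in \<open>A\<close>, so it
  suffices to compare them on cylinders, where independence reduces the claim to single
  coordinates.\<close>

lemma elapse_memoryless:
  assumes "0 \<le> \<tau>" "A \<in> sets clocks"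
  shows "emeasure clocks {\<omega> \<in> space clocks. (\<forall>s'\<in>S - {s}. \<tau> < \<omega> (s', 0)) \<and> elapse s \<tau> \<omega> \<in> A}
    = ennreal (exp (- \<tau> * sum r (S - {s}))) * emeasure clocks A"
proof -
  define F where "F = {\<omega> \<in> space clocks. \<forall>s'\<in>S - {s}. \<tau> < \<omega> (s', 0)}"
  have F [measurable]: "F \<in> sets clocks"
    unfolding F_def
  proof (rule sets.sets_Collect_finite_All)
    fix s' assume "s' \<in> S - {s}"
    then have [measurable]: "(\<lambda>\<omega>. \<omega> (s', 0)) \<in> borel_measurable clocks" by (intro wait_component) auto
    show "{\<omega> \<in> space clocks. \<tau> < \<omega> (s', 0)} \<in> sets clocks" by measurable
  qed (use finite_S in auto)
  have e [measurable]: "elapse s \<tau> \<in> clocks \<rightarrow>\<^sub>M clocks"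
    by measurable
  define P where "P = distr (density clocks (indicator F)) clocks (elapse s \<tau>)"
  define c where "c = exp (- \<tau> * sum r (S - {s}))"
  have P_eq: "emeasure P B = emeasure clocks {\<omega> \<in> space clocks. (\<forall>s'\<in>S - {s}. \<tau> < \<omega> (s', 0)) \<and> elapse s \<tau> \<omega> \<in> B}"
    if [measurable]: "B \<in> sets clocks" for B
  proof -
    have "emeasure P B = emeasure (density clocks (indicator F)) (elapse s \<tau> -` B \<inter> space clocks)"
      unfolding P_def by (subst emeasure_distr) auto
    also have "\<dots> = (\<integral>\<^sup>+ x. indicator F x * indicator (elapse s \<tau> -` B \<inter> space clocks) x \<partial>clocks)"
      by (subst emeasure_density) auto
    also have "\<dots> = (\<integral>\<^sup>+ x. indicator (F \<inter> (elapse s \<tau> -` B \<inter> space clocks)) x \<partial>clocks)"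
      by (simp add: indicator_inter_arith)
    also have "\<dots> = emeasure clocks (F \<inter> (elapse s \<tau> -` B \<inter> space clocks))"
      by (rule nn_integral_indicator) measurable
    also have "F \<inter> (elapse s \<tau> -` B \<inter> space clocks)
        = {\<omega> \<in> space clocks. (\<forall>s'\<in>S - {s}. \<tau> < \<omega> (s', 0)) \<and> elapse s \<tau> \<omega> \<in> B}"
      by (auto simp: F_def)
    finally show ?thesis .
  qed
  have "P = density clocks (\<lambda>_. ennreal c)"
  proof (rule measure_eqI_PiM_infinite)
    show "sets P = sets clocks" by (simp add: P_def)
    show "sets (density clocks (\<lambda>_. ennreal c)) = sets clocks" by simp
    show "finite_measure P"
    proof
      have "emeasure P (space P) \<le> emeasure clocks (space clocks)"
        using P_eq[OF sets.top] by (auto simp: P_def intro!: emeasure_mono)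
      then show "emeasure P (space P) \<noteq> \<infinity>"
        using emeasure_space_1 by (auto simp: top_unique)
    qed
    fix A J0 assume J0: "finite J0" "J0 \<subseteq> S \<times> (UNIV :: nat set)" and A0: "\<And>i. i \<in> J0 \<Longrightarrow> A i \<in> sets (wtime i)"
    \<comment> \<open>The first waits of all clocks other than \<open>s\<close> join the index set,
      with the trivial constraint \<open>UNIV\<close> unless already present. The event of no ring
      up to \<tau> then concerns coordinates of the same finite set \<open>J\<close>.\<close>
    define J1 :: "('a \<times> nat) set" where "J1 = (S - {s}) \<times> {0}"
    define J where "J = J0 \<union> J1"
    define A' where "A' x = (if x \<in> J0 then A x else UNIV)" for x
    have J: "finite J" "J \<subseteq> S \<times> UNIV" using J0 finite_S by (auto simp: J_def J1_def)
    have A': "A' x \<in> sets (wtime x)" for x using A0 by (auto simp: A'_def)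
    have A'b [measurable]: "A' x \<in> sets borel" for x using A'[of x] by simp
    define B where "B x = {y. (x \<in> J1 \<longrightarrow> \<tau> < y) \<and> (if x \<in> J1 then y - \<tau> else y) \<in> A' x}" for x
    have Bsets: "B x \<in> sets (wtime x)" for x
      by (auto simp: B_def)
    have box: "prod_emb (S \<times> UNIV) wtime J0 (Pi\<^sub>E J0 A) = {\<omega> \<in> space clocks. \<forall>x\<in>J. \<omega> x \<in> A' x}"
      using J0 by (auto simp: prod_emb_def space_PiM A'_def J_def PiE_iff extensional_def restrict_def split: if_splits)
    have boxs: "{\<omega> \<in> space clocks. \<forall>x\<in>J. \<omega> x \<in> A' x} \<in> sets clocks"
      using box sets_PiM_I[of J0 "S \<times> UNIV" A wtime] J0 A0 by metis
    have "emeasure P {\<omega> \<in> space clocks. \<forall>x\<in>J. \<omega> x \<in> A' x}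
        = emeasure clocks {\<omega> \<in> space clocks. \<forall>x\<in>J. \<omega> x \<in> B x}"
    proof (subst P_eq[OF boxs], rule arg_cong[where f = "emeasure clocks"], intro Collect_cong conj_cong refl)
      fix \<omega> assume w: "\<omega> \<in> space clocks"
      then have ew: "elapse s \<tau> \<omega> \<in> space clocks" using measurable_space[OF e] by blast
      have "(\<forall>s'\<in>S - {s}. \<tau> < \<omega> (s', 0)) \<longleftrightarrow> (\<forall>x\<in>J. x \<in> J1 \<longrightarrow> \<tau> < \<omega> x)"
        by (auto simp: J_def J1_def)
      moreover have "elapse s \<tau> \<omega> x = (if x \<in> J1 then \<omega> x - \<tau> else \<omega> x)" if "x \<in> J" for x
        using that J by (auto simp: elapse_def J1_def)
      ultimately show "((\<forall>s'\<in>S - {s}. \<tau> < \<omega> (s', 0)) \<and> elapse s \<tau> \<omega> \<in> {\<omega> \<in> space clocks. \<forall>x\<in>J. \<omega> x \<in> A' x})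
          = (\<forall>x\<in>J. \<omega> x \<in> B x)"
        using ew by (auto simp: B_def)
    qed
    also have "\<dots> = (\<Prod>x\<in>J. emeasure (wtime x) (B x))"
      using J Bsets by (intro emeasure_PiM_Collect) auto
    also have "\<dots> = (\<Prod>x\<in>J. ennreal (if x \<in> J1 then exp (- \<tau> * r (fst x)) else 1) * emeasure (wtime x) (A' x))"
    proof (rule prod.cong[OF refl])
      fix x
      show "emeasure (wtime x) (B x) = ennreal (if x \<in> J1 then exp (- \<tau> * r (fst x)) else 1) * emeasure (wtime x) (A' x)"
        using emeasure_wait_shift[OF assms(1) A'b, of x x] by (auto simp: B_def)
    qed
    also have "\<dots> = ennreal (\<Prod>x\<in>J. if x \<in> J1 then exp (- \<tau> * r (fst x)) else 1) * (\<Prod>x\<in>J. emeasure (wtime x) (A' x))"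
      by (simp add: prod.distrib prod_ennreal)
    also have "(\<Prod>x\<in>J. if x \<in> J1 then exp (- \<tau> * r (fst x)) else 1) = (\<Prod>x\<in>J1. exp (- \<tau> * r (fst x)))"
      using J by (subst prod.If_cases) (auto simp: J_def Int_absorb1 Int_commute)
    also have "\<dots> = exp (\<Sum>x\<in>J1. - \<tau> * r (fst x))"
      using finite_S by (subst exp_sum) (auto simp: J1_def)
    also have "(\<Sum>x\<in>J1. - \<tau> * r (fst x)) = - \<tau> * sum r (S - {s})"
      unfolding J1_def sum_distrib_left
      by (rule sum.reindex_bij_witness[of _ "\<lambda>x. (x, 0)" fst]) auto
    also have "(\<Prod>x\<in>J. emeasure (wtime x) (A' x)) = emeasure clocks {\<omega> \<in> space clocks. \<forall>x\<in>J. \<omega> x \<in> A' x}"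
      using J A' by (intro emeasure_PiM_Collect[symmetric]) auto
    finally show "emeasure P (prod_emb (S \<times> UNIV) wtime J0 (Pi\<^sub>E J0 A))
        = emeasure (density clocks (\<lambda>_. ennreal c)) (prod_emb (S \<times> UNIV) wtime J0 (Pi\<^sub>E J0 A))"
      using boxs by (simp add: box c_def emeasure_density nn_integral_cmult_indicator)
  qed
  then show ?thesis
    using P_eq[OF assms(2)] assms(2) by (simp add: c_def emeasure_density nn_integral_cmult_indicator)
qed

text \<open>Disintegration along the coordinate \<open>(s, 0)\<close>: the remaining coordinates,
  with the counter of \<open>s\<close> lowered by one, again form an independent family of the
  original kind.\<close>

lemma emeasure_first_wait:
  assumes s: "s \<in> S" and E: "E \<in> sets clocks"
  shows "emeasure clocks E = (\<integral>\<^sup>+ \<tau>. emeasure clocks {\<omega> \<in> space clocks. insert_first s \<tau> \<omega> \<in> E} \<partial>wtime (s, 0))"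
proof -
  let ?I = "S \<times> (UNIV :: nat set)"
  define I' where "I' = ?I - {(s, 0)}"
  have ins: "insert (s, 0) I' = ?I" using s by (auto simp: I'_def)
  \<comment> \<open>Matches the positions other than \<open>(s, 0)\<close> with positions of the
    full index set. On \<open>I'\<close> the subtraction never truncates, and the law of a wait
    depends only on its label.\<close>
  define f where "f x = (if fst x = s then (s, snd x - 1) else x)" for x :: "'a \<times> nat"
  have f: "inj_on f I'" "f \<in> I' \<rightarrow> ?I"
    using s by (auto simp: inj_on_def f_def I'_def split: if_splits)
  let ?N = "Pi\<^sub>M I' wtime"
  have ps: "prob_space (wtime x)" for x
    by (intro prob_space_exponential_density rate_pos)
  have d1: "distr (wtime (s, 0) \<Otimes>\<^sub>M ?N) clocks (\<lambda>(x, X). X((s, 0) := x)) = clocks"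
    using distr_pair_PiM_eq_PiM[of I' wtime "(s, 0)"] ps unfolding ins by blast
  have m1: "(\<lambda>(x, X). X((s, 0) := x)) \<in> wtime (s, 0) \<Otimes>\<^sub>M ?N \<rightarrow>\<^sub>M clocks"
    using measurable_add_dim[of "(s, 0)" I' wtime] measurable_compose[OF measurable_pair_swap' measurable_add_dim[of "(s, 0)" I' wtime]]
    unfolding ins by (simp add: split_beta' o_def)
  have wf: "wtime (f x) = wtime x" for x by (auto simp: f_def)
  have d2: "distr clocks ?N (\<lambda>\<omega>. \<lambda>n\<in>I'. \<omega> (f n)) = ?N"
    using distr_PiM_reindex[of ?I wtime f I'] ps f wf by simp
  have m2: "(\<lambda>\<omega>. \<lambda>n\<in>I'. \<omega> (f n)) \<in> clocks \<rightarrow>\<^sub>M ?N"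
  proof (rule measurable_restrict)
    fix x assume "x \<in> I'"
    then have "f x \<in> ?I" using f by auto
    then show "(\<lambda>\<omega>. \<omega> (f x)) \<in> clocks \<rightarrow>\<^sub>M wtime x"
      using measurable_component_singleton[of "f x" ?I wtime] by (simp only: wf)
  qed
  interpret N: prob_space ?N using ps by (rule prob_space_PiM)
  have "emeasure clocks E = emeasure (wtime (s, 0) \<Otimes>\<^sub>M ?N) ((\<lambda>(x, X). X((s, 0) := x)) -` E \<inter> space (wtime (s, 0) \<Otimes>\<^sub>M ?N))"
    by (subst d1[symmetric]) (rule emeasure_distr[OF m1 E])
  also have "\<dots> = (\<integral>\<^sup>+ \<tau>. emeasure ?N (Pair \<tau> -` ((\<lambda>(x, X). X((s, 0) := x)) -` E \<inter> space (wtime (s, 0) \<Otimes>\<^sub>M ?N))) \<partial>wtime (s, 0))"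
    by (rule N.emeasure_pair_measure_alt) (rule measurable_sets[OF m1 E])
  also have "\<dots> = (\<integral>\<^sup>+ \<tau>. emeasure clocks {\<omega> \<in> space clocks. insert_first s \<tau> \<omega> \<in> E} \<partial>wtime (s, 0))"
  proof (rule nn_integral_cong)
    fix \<tau> assume t: "\<tau> \<in> space (wtime (s, 0))"
    let ?X = "Pair \<tau> -` ((\<lambda>(x, X). X((s, 0) := x)) -` E \<inter> space (wtime (s, 0) \<Otimes>\<^sub>M ?N))"
    have X: "?X \<in> sets ?N" by (rule sets_Pair1[OF measurable_sets[OF m1 E]])
    have "emeasure ?N ?X = emeasure clocks ((\<lambda>\<omega>. \<lambda>n\<in>I'. \<omega> (f n)) -` ?X \<inter> space clocks)"
      by (subst (1) d2[symmetric]) (rule emeasure_distr[OF m2 X])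
    also have "(\<lambda>\<omega>. \<lambda>n\<in>I'. \<omega> (f n)) -` ?X \<inter> space clocks = {\<omega> \<in> space clocks. insert_first s \<tau> \<omega> \<in> E}"
    proof -
      have "((\<lambda>n\<in>I'. \<omega> (f n))((s, 0) := \<tau>)) = insert_first s \<tau> \<omega>" for \<omega>
        by (auto simp: fun_eq_iff insert_first_def I'_def f_def s split: nat.splits)
      moreover have "(\<lambda>n\<in>I'. \<omega> (f n)) \<in> space ?N" if "\<omega> \<in> space clocks" for \<omega>
        using measurable_space[OF m2 that] .
      ultimately show ?thesis by (auto simp: space_pair_measure)
    qed
    finally show "emeasure ?N ?X = emeasure clocks {\<omega> \<in> space clocks. insert_first s \<tau> \<omega> \<in> E}" .
  qed
  finally show ?thesis .
qed


section \<open>The probability that the clocks spell a given word\<close>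

lemma drop_first_insert_first:
  assumes "s \<in> S" "\<omega> \<in> space clocks"
  shows "drop_first s (insert_first s \<tau> \<omega>) = \<omega>"
  using assms by (auto simp: fun_eq_iff drop_first_def insert_first_def space_PiM PiE_iff extensional_def)

lemma measurable_insert_first:
  assumes s: "s \<in> S"
  shows "insert_first s \<tau> \<in> clocks \<rightarrow>\<^sub>M clocks"
  unfolding insert_first_def
proof (rule measurable_restrict)
  fix x assume [measurable]: "x \<in> S \<times> (UNIV :: nat set)"
  have [measurable]: "(s, i) \<in> S \<times> UNIV" for i :: nat using assms by simp
  show "(\<lambda>z. if fst x = s then case snd x of 0 \<Rightarrow> \<tau> | Suc i \<Rightarrow> z (s, i) else z x) \<in> clocks \<rightarrow>\<^sub>M wtime x"
    by (cases "snd x") (auto cong: measurable_cong_sets)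
qed

text \<open>\<open>rings_word w t\<close> is the event that the rings up to time \<open>t\<close> have chronological label list \<open>w\<close>.
  By memorylessness, after the first ring, at \<open>s\<close>, all clocks restart afresh: those other than \<open>s\<close>
  with the elapsed time deducted, that of \<open>s\<close> with its next waiting time.\<close>

primrec rings_word :: "'a list \<Rightarrow> real \<Rightarrow> ('a \<times> nat \<Rightarrow> real) \<Rightarrow> bool" where
  "rings_word [] t \<omega> \<longleftrightarrow> (\<forall>s\<in>S. t < \<omega> (s, 0))"
| "rings_word (s # w) t \<omega> \<longleftrightarrow> 0 \<le> \<omega> (s, 0) \<and> \<omega> (s, 0) \<le> t \<and> (\<forall>s'\<in>S - {s}. \<omega> (s, 0) < \<omega> (s', 0)) \<and>
     rings_word w (t - \<omega> (s, 0)) (elapse s (\<omega> (s, 0)) (drop_first s \<omega>))"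

lemma pred_rings_word [measurable]:
  assumes "set w \<subseteq> S"
  shows "Measurable.pred (borel \<Otimes>\<^sub>M clocks) (\<lambda>(t, \<omega>). rings_word w t \<omega>)"
  using assms
proof (induction w)
  case Nil
  have "Measurable.pred (borel \<Otimes>\<^sub>M clocks) (\<lambda>x. \<forall>s\<in>S. fst x < snd x (s, 0))"
  proof (rule pred_intros_finite(3)[OF finite_S])
    fix s assume "s \<in> S"
    then have [measurable]: "(\<lambda>\<omega>. \<omega> (s, 0)) \<in> borel_measurable clocks" by (intro wait_component) auto
    show "Measurable.pred (borel \<Otimes>\<^sub>M clocks) (\<lambda>x. fst x < snd x (s, 0))" by measurable
  qed
  then show ?case by (simp add: split_beta')
next
  case (Cons s w)
  then have s: "s \<in> S" and pw: "Measurable.pred (borel \<Otimes>\<^sub>M clocks) (\<lambda>(t, \<omega>). rings_word w t \<omega>)"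
    by auto
  have [measurable]: "(\<lambda>\<omega>. \<omega> (s', 0)) \<in> borel_measurable clocks" if "s' \<in> S" for s'
    using that by (intro wait_component) auto
  note s [measurable]
  have [measurable]: "Measurable.pred (borel \<Otimes>\<^sub>M clocks) (\<lambda>x. \<forall>s'\<in>S - {s}. snd x (s, 0) < snd x (s', 0))"
  proof (rule pred_intros_finite(3))
    fix s' assume "s' \<in> S - {s}"
    then have [measurable]: "s' \<in> S" by simp
    show "Measurable.pred (borel \<Otimes>\<^sub>M clocks) (\<lambda>x. snd x (s, 0) < snd x (s', 0))" by measurable
  qed (use finite_S in simp)
  have [measurable]: "(\<lambda>x. (case (snd x (s, 0), drop_first s (snd x)) of (\<tau>, \<omega>) \<Rightarrow> elapse s \<tau> \<omega>))
      \<in> borel \<Otimes>\<^sub>M clocks \<rightarrow>\<^sub>M clocks"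
    by (rule measurable_compose[OF _ measurable_elapse]) measurable
  have "Measurable.pred (borel \<Otimes>\<^sub>M clocks) (\<lambda>x. case (fst x - snd x (s, 0), elapse s (snd x (s, 0)) (drop_first s (snd x))) of
      (t, \<omega>) \<Rightarrow> rings_word w t \<omega>)"
    by (rule measurable_compose[OF _ pw]) measurable
  then have [measurable]: "Measurable.pred (borel \<Otimes>\<^sub>M clocks)
      (\<lambda>x. rings_word w (fst x - snd x (s, 0)) (elapse s (snd x (s, 0)) (drop_first s (snd x))))"
    by simp
  show ?case
    unfolding rings_word.simps split_beta' by measurable
qed

lemma sets_rings_word [measurable]:
  assumes "set w \<subseteq> S"
  shows "{\<omega> \<in> space clocks. rings_word w t \<omega>} \<in> sets clocks"
proof -
  have "Measurable.pred clocks (\<lambda>\<omega>. case (t, \<omega>) of (t, \<omega>) \<Rightarrow> rings_word w t \<omega>)"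
    by (rule measurable_compose[OF _ pred_rings_word[OF assms]]) measurable
  then show ?thesis by simp
qed

text \<open>Conditioning on the first ring at \<tau> leaves the shorter word for the time
  \<open>t - \<tau>\<close>. The exponentials always combine to \<open>exp (- t * sum r S)\<close>,
  the rates multiply, and repeated integration of powers of \<open>t - \<tau>\<close> yields the
  simplex volume.\<close>

lemma emeasure_rings_word:
  assumes "set w \<subseteq> S" "0 \<le> t"
  shows "emeasure clocks {\<omega> \<in> space clocks. rings_word w t \<omega>}
    = ennreal (prod_list (map r w) * (t ^ length w / fact (length w)) * exp (- t * sum r S))"
  using assms
proof (induction w arbitrary: t)
  case Nil
  have "emeasure clocks {\<omega> \<in> space clocks. rings_word [] t \<omega>}
      = emeasure clocks {\<omega> \<in> space clocks. \<forall>x\<in>S \<times> {0::nat}. \<omega> x \<in> {t<..}}"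
    by (rule arg_cong[where f = "emeasure clocks"]) auto
  also have "\<dots> = (\<Prod>x\<in>S \<times> {0::nat}. emeasure (wtime x) {t<..})"
    using finite_S by (intro emeasure_PiM_Collect) auto
  also have "\<dots> = (\<Prod>x\<in>S \<times> {0::nat}. ennreal (exp (- t * r (fst x))))"
  proof (rule prod.cong[OF refl])
    fix x :: "'a \<times> nat"
    have "{y. t < y \<and> y - t \<in> UNIV} = {t<..}" by auto
    then show "emeasure (wtime x) {t<..} = ennreal (exp (- t * r (fst x)))"
      using emeasure_wait_shift[of t UNIV x] Nil M.emeasure_space_1[of x] by simp
  qed
  also have "\<dots> = ennreal (exp (\<Sum>x\<in>S \<times> {0::nat}. - t * r (fst x)))"
    using finite_S by (simp add: prod_ennreal exp_sum)
  also have "(\<Sum>x\<in>S \<times> {0::nat}. - t * r (fst x)) = - t * sum r S"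
    unfolding sum_distrib_left by (rule sum.reindex_bij_witness[of _ "\<lambda>x. (x, 0)" fst]) auto
  finally show ?case by simp
next
  case (Cons s w)
  then have s: "s \<in> S" and w: "set w \<subseteq> S" by auto
  define L where "L = sum r S"
  define N where "N = length w"
  have L: "L = r s + sum r (S - {s})" unfolding L_def using s finite_S by (simp add: sum.remove)
  define C where "C = prod_list (map r w) * r s * exp (- t * L)"
  have C: "0 \<le> C" unfolding C_def using rate_pos by (intro mult_nonneg_nonneg prod_list_nonneg) (auto intro: less_imp_le)
  let ?E = "{\<omega> \<in> space clocks. rings_word (s # w) t \<omega>}"
  have "emeasure clocks ?E = (\<integral>\<^sup>+ \<tau>. emeasure clocks {\<omega> \<in> space clocks. insert_first s \<tau> \<omega> \<in> ?E} \<partial>wtime (s, 0))"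
    using Cons.prems by (intro emeasure_first_wait s sets_rings_word)
  also have "\<dots> = (\<integral>\<^sup>+ \<tau>. indicator {0..t} \<tau> *
      ennreal (exp (- \<tau> * sum r (S - {s})) * (prod_list (map r w) * ((t - \<tau>) ^ N / fact N) * exp (- (t - \<tau>) * L))) \<partial>wtime (s, 0))"
  proof (rule nn_integral_cong)
    fix \<tau>
    have ifs: "insert_first s \<tau> \<omega> \<in> space clocks" if "\<omega> \<in> space clocks" for \<omega>
      using measurable_space[OF measurable_insert_first[OF s] that] .
    have el: "elapse s \<tau> \<omega> \<in> space clocks" if "\<omega> \<in> space clocks" for \<omega>
    proof -
      have "(\<lambda>\<omega>. case (\<tau>, \<omega>) of (\<tau>, \<omega>) \<Rightarrow> elapse s \<tau> \<omega>) \<in> clocks \<rightarrow>\<^sub>M clocks"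
        by (rule measurable_compose[OF _ measurable_elapse]) measurable
      from measurable_space[OF this that] show ?thesis by simp
    qed
    have eq: "(insert_first s \<tau> \<omega> \<in> ?E) = (0 \<le> \<tau> \<and> \<tau> \<le> t \<and> (\<forall>s'\<in>S - {s}. \<tau> < \<omega> (s', 0)) \<and>
        elapse s \<tau> \<omega> \<in> {\<omega> \<in> space clocks. rings_word w (t - \<tau>) \<omega>})" if "\<omega> \<in> space clocks" for \<omega>
    proof -
      have "insert_first s \<tau> \<omega> (s, 0) = \<tau>" "\<And>s'. s' \<in> S - {s} \<Longrightarrow> insert_first s \<tau> \<omega> (s', 0) = \<omega> (s', 0)"
        using s by (auto simp: insert_first_def)
      then show ?thesis
        using that ifs[OF that] el[OF that] by (simp add: drop_first_insert_first[OF s that])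
    qed
    show "emeasure clocks {\<omega> \<in> space clocks. insert_first s \<tau> \<omega> \<in> ?E} = indicator {0..t} \<tau> *
        ennreal (exp (- \<tau> * sum r (S - {s})) * (prod_list (map r w) * ((t - \<tau>) ^ N / fact N) * exp (- (t - \<tau>) * L)))"
    proof (cases "0 \<le> \<tau> \<and> \<tau> \<le> t")
      case True
      have "emeasure clocks {\<omega> \<in> space clocks. insert_first s \<tau> \<omega> \<in> ?E}
          = emeasure clocks {\<omega> \<in> space clocks. (\<forall>s'\<in>S - {s}. \<tau> < \<omega> (s', 0)) \<and>
          elapse s \<tau> \<omega> \<in> {\<omega> \<in> space clocks. rings_word w (t - \<tau>) \<omega>}}"
      proof (intro arg_cong[where f = "emeasure clocks"] Collect_cong conj_cong refl)
        fix \<omega> assume "\<omega> \<in> space clocks"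
        from eq[OF this] True show "(insert_first s \<tau> \<omega> \<in> ?E) = ((\<forall>s'\<in>S - {s}. \<tau> < \<omega> (s', 0)) \<and>
            elapse s \<tau> \<omega> \<in> {\<omega> \<in> space clocks. rings_word w (t - \<tau>) \<omega>})"
          by (simp only: simp_thms)
      qed
      also have "\<dots> = ennreal (exp (- \<tau> * sum r (S - {s}))) * emeasure clocks {\<omega> \<in> space clocks. rings_word w (t - \<tau>) \<omega>}"
        using True by (intro elapse_memoryless sets_rings_word w) simp
      also have "\<dots> = ennreal (exp (- \<tau> * sum r (S - {s}))) *
          ennreal (prod_list (map r w) * ((t - \<tau>) ^ N / fact N) * exp (- (t - \<tau>) * L))"
        using True by (subst Cons.IH[OF w]) (simp_all add: N_def L_def)
      also have "\<dots> = ennreal (exp (- \<tau> * sum r (S - {s})) * (prod_list (map r w) * ((t - \<tau>) ^ N / fact N) * exp (- (t - \<tau>) * L)))"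
        by (rule ennreal_mult'[symmetric]) simp
      finally show ?thesis using True by simp
    next
      case False
      then have "{\<omega> \<in> space clocks. insert_first s \<tau> \<omega> \<in> ?E} = {}"
        using eq by blast
      then have "emeasure clocks {\<omega> \<in> space clocks. insert_first s \<tau> \<omega> \<in> ?E} = 0" by (simp only: emeasure_empty)
      then show ?thesis using False by (auto simp: indicator_def)
    qed
  qed
  also have "\<dots> = (\<integral>\<^sup>+ \<tau>. ennreal (exponential_density (r s) \<tau>) * (indicator {0..t} \<tau> *
      ennreal (exp (- \<tau> * sum r (S - {s})) * (prod_list (map r w) * ((t - \<tau>) ^ N / fact N) * exp (- (t - \<tau>) * L)))) \<partial>lborel)"
    by (subst nn_integral_density) auto
  also have "\<dots> = (\<integral>\<^sup>+ \<tau>. ennreal (C * ((t - \<tau>) ^ N / fact N)) * indicator {0..t} \<tau> \<partial>lborel)"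
  proof (rule nn_integral_cong)
    fix \<tau>
    \<comment> \<open>The density of the first ring and the survival of the other clocks up to
      \<tau> together give decay at the total rate \<open>L\<close>, which the remaining time
      continues.\<close>
    have "exp (- (\<tau> * r s)) * (exp (- (\<tau> * sum r (S - {s}))) * exp (\<tau> * L)) = 1"
      by (simp add: exp_add[symmetric] L algebra_simps)
    then have eq: "r s * exp (- \<tau> * r s) *
        (exp (- \<tau> * sum r (S - {s})) * (prod_list (map r w) * ((t - \<tau>) ^ N / fact N) * exp (- (t - \<tau>) * L)))
        = C * ((t - \<tau>) ^ N / fact N)"
      by (simp add: C_def algebra_simps exp_diff exp_minus divide_simps)
    show "ennreal (exponential_density (r s) \<tau>) * (indicator {0..t} \<tau> *
      ennreal (exp (- \<tau> * sum r (S - {s})) * (prod_list (map r w) * ((t - \<tau>) ^ N / fact N) * exp (- (t - \<tau>) * L))))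
      = ennreal (C * ((t - \<tau>) ^ N / fact N)) * indicator {0..t} \<tau>"
    proof (cases "\<tau> \<in> {0..t}")
      case True
      then have "exponential_density (r s) \<tau> = r s * exp (- \<tau> * r s)" by (simp add: exponential_density_def)
      then show ?thesis using True by (simp only: indicator_simps mult_1_left mult_1_right) (subst ennreal_mult'[symmetric], use rate_pos[of s] in simp, simp only: eq)
    qed simp
  qed
  also have "\<dots> = ennreal (- C * ((t - t) ^ Suc N / fact (Suc N)) - (- C * ((t - 0) ^ Suc N / fact (Suc N))))"
  proof (rule nn_integral_FTC_Icc[where F = "\<lambda>\<tau>. - C * ((t - \<tau>) ^ Suc N / fact (Suc N))"])
    show "(\<lambda>\<tau>. C * ((t - \<tau>) ^ N / fact N)) \<in> borel_measurable borel" by measurable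
  next
    fix \<tau> assume "\<tau> \<in> {0..t}"
    then show "0 \<le> C * ((t - \<tau>) ^ N / fact N)" using C by simp
  next
    fix \<tau> assume "\<tau> \<in> {0..t}"
    show "((\<lambda>\<tau>. - C * ((t - \<tau>) ^ Suc N / fact (Suc N))) has_real_derivative C * ((t - \<tau>) ^ N / fact N)) (at \<tau>)"
      by (rule derivative_eq_intros refl | simp)+
  qed (use Cons.prems in auto)
  also have "\<dots> = ennreal (prod_list (map r (s # w)) * (t ^ length (s # w) / fact (length (s # w))) * exp (- t * sum r S))"
    by (simp add: C_def N_def L_def algebra_simps)
  finally show ?case .
qed

end

section \<open>Sums over words of fixed length\<close>

lemma sum_words_Suc:
  assumes "finite S"
  shows "(\<Sum>w | set w \<subseteq> S \<and> length w = Suc n. f w) = (\<Sum>s\<in>S. \<Sum>w | set w \<subseteq> S \<and> length w = n. f (s # w))"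
proof -
  have "(\<Sum>w | set w \<subseteq> S \<and> length w = Suc n. f w)
      = (\<Sum>(w, s) \<in> {w. set w \<subseteq> S \<and> length w = n} \<times> S. f (s # w))"
    unfolding lists_length_Suc_eq by (subst sum.reindex) (auto simp: inj_on_def split_beta')
  also have "\<dots> = (\<Sum>w | set w \<subseteq> S \<and> length w = n. \<Sum>s\<in>S. f (s # w))"
    by (simp add: sum.cartesian_product)
  also have "\<dots> = (\<Sum>s\<in>S. \<Sum>w | set w \<subseteq> S \<and> length w = n. f (s # w))"
    by (rule sum.swap)
  finally show ?thesis .
qed

lemma sum_prod_list_words:
  fixes r :: "'a \<Rightarrow> 'b::comm_semiring_1"
  assumes "finite S"
  shows "(\<Sum>w | set w \<subseteq> S \<and> length w = n. prod_list (map r w)) = sum r S ^ n"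
proof (induction n)
  case 0
  have "{w. set w \<subseteq> S \<and> length w = 0} = {[]}" by auto
  then show ?case by simp
next
  case (Suc n)
  then show ?case
    by (simp add: sum_words_Suc[OF assms] sum_distrib_left[symmetric] sum_distrib_right[symmetric])
qed

section \<open>Chronological lists of rings\<close>

context poisson_clocks begin

text \<open>The condition that \<open>rings_upto\<close> puts under its \<open>THE\<close>, with
  \<open>S\<close> in the role of the rate support.\<close>

definition chronological :: "real \<Rightarrow> ('a \<times> nat \<Rightarrow> real) \<Rightarrow> ('a \<times> nat) list \<Rightarrow> bool" where
  "chronological t \<omega> xs \<longleftrightarrow> set xs = {x \<in> S \<times> UNIV. ring_time \<omega> x \<le> t} \<and>
     sorted_wrt (\<lambda>x y. ring_time \<omega> x < ring_time \<omega> y) xs"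

text \<open>A strictly sorted list is determined by its set of values. Strictness also makes
  \<open>ring_time\<close> injective on the listed rings, so these are determined by their
  times.\<close>

lemma chronological_unique:
  assumes "chronological t \<omega> xs" "chronological t \<omega> ys"
  shows "xs = ys"
proof -
  have *: "sorted_wrt (<) (map (ring_time \<omega>) zs)" if "chronological t \<omega> zs" for zs
    using that by (simp add: chronological_def sorted_wrt_map)
  have "set (map (ring_time \<omega>) xs) = set (map (ring_time \<omega>) ys)"
    using assms by (simp add: chronological_def)
  with *[OF assms(1)] *[OF assms(2)] have eq: "map (ring_time \<omega>) xs = map (ring_time \<omega>) ys"
    by (intro strict_sorted_equal) auto
  have "distinct (map (ring_time \<omega>) xs)" using *[OF assms(1)] by (simp add: strict_sorted_iff)
  then have "inj_on (ring_time \<omega>) (set xs)" by (simp add: distinct_map)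
  moreover have "set ys = set xs" using assms by (simp add: chronological_def)
  ultimately have "inj_on (ring_time \<omega>) (set xs \<union> set ys)" by simp
  from map_inj_on[OF eq this] show ?thesis .
qed

lemma first_wait_le_ring_time:
  assumes "\<And>x. x \<in> S \<times> UNIV \<Longrightarrow> 0 < \<omega> x" "x \<in> S \<times> UNIV"
  shows "\<omega> (fst x, 0) \<le> ring_time \<omega> x"
proof -
  obtain s k where x: "x = (s, k)" by (cases x)
  have "0 \<le> \<omega> (s, i)" for i using assms(1)[of "(s, i)"] assms(2) x by simp
  then have "\<omega> (s, 0) \<le> (\<Sum>i\<le>k. \<omega> (s, i))" by (intro member_le_sum) auto
  then show ?thesis by (simp add: x ring_time_def)
qed

text \<open>Links the recursive event to the description by ring times: the list of the restarted
  clocks is translated back and the first ring \<open>(s, 0)\<close> is put in front.\<close>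

lemma chronological_rings_word:
  assumes "set w \<subseteq> S" "\<And>x. x \<in> S \<times> UNIV \<Longrightarrow> 0 < \<omega> x" "rings_word w t \<omega>"
  shows "\<exists>xs. chronological t \<omega> xs \<and> map fst xs = w"
  using assms
proof (induction w arbitrary: t \<omega>)
  case Nil
  have "t < ring_time \<omega> x" if "x \<in> S \<times> UNIV" for x
    using first_wait_le_ring_time[of \<omega> x] Nil that by fastforce
  then have "chronological t \<omega> []" unfolding chronological_def using leD by fastforce
  then show ?case by auto
next
  case (Cons s w)
  have s: "s \<in> S" using Cons.prems by auto
  define \<tau> where "\<tau> = \<omega> (s, 0)"
  define \<omega>' where "\<omega>' = elapse s \<tau> (drop_first s \<omega>)"
  have t: "\<tau> \<le> t" "\<And>s'. s' \<in> S - {s} \<Longrightarrow> \<tau> < \<omega> (s', 0)" and w: "rings_word w (t - \<tau>) \<omega>'"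
    using Cons.prems by (auto simp: \<tau>_def \<omega>'_def)
  have ws: "\<omega>' (s, i) = \<omega> (s, Suc i)" for i using s by (simp add: \<omega>'_def elapse_def drop_first_def)
  have wo: "\<omega>' (a, i) = (if i = 0 then \<omega> (a, 0) - \<tau> else \<omega> (a, i))" if "a \<in> S" "a \<noteq> s" for a i
    using that by (simp add: \<omega>'_def elapse_def drop_first_def)
  have pos: "0 < \<omega>' x" if "x \<in> S \<times> UNIV" for x
    using that Cons.prems(2) t(2) ws wo by (cases x; cases "fst x = s") (auto simp: mem_Times_iff)
  from Cons.IH[OF _ pos w] Cons.prems(1) obtain xs where xs: "chronological (t - \<tau>) \<omega>' xs" "map fst xs = w"
    by auto
  \<comment> \<open>Ring k of the restarted clock \<open>s\<close> is ring k + 1 of the original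
    one; the other clocks keep their numbering.\<close>
  define up where "up x = (fst x, if fst x = s then Suc (snd x) else snd x)" for x :: "'a \<times> nat"
  \<comment> \<open>Restarting shifts all ring times by \<tau>: for \<open>s\<close> this is the
    dropped first wait, for the others the amount deducted from theirs.\<close>
  have rt: "ring_time \<omega> (up x) = \<tau> + ring_time \<omega>' x" if "x \<in> S \<times> UNIV" for x
  proof -
    obtain a k where x: "x = (a, k)" by (cases x)
    show ?thesis
    proof (cases "a = s")
      case True
      have "(\<Sum>i\<le>Suc k. \<omega> (s, i)) = \<omega> (s, 0) + (\<Sum>i\<le>k. \<omega> (s, Suc i))" by (rule sum.atMost_Suc_shift)
      then show ?thesis using True by (simp add: x up_def ring_time_def ws \<tau>_def)
    next
      case False
      with that x have "a \<in> S" by simp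
      have "(\<Sum>i\<le>k. \<omega> (a, i)) = \<tau> + (\<Sum>i\<le>k. \<omega>' (a, i))"
        by (induction k) (use wo[OF \<open>a \<in> S\<close> False] in auto)
      then show ?thesis using False by (simp add: x up_def ring_time_def)
    qed
  qed
  have "chronological t \<omega> ((s, 0) # map up xs)"
    unfolding chronological_def
  proof
    have setxs: "set xs = {x \<in> S \<times> UNIV. ring_time \<omega>' x \<le> t - \<tau>}" using xs by (simp add: chronological_def)
    show "set ((s, 0) # map up xs) = {x \<in> S \<times> UNIV. ring_time \<omega> x \<le> t}"
    proof (intro equalityI subsetI)
      fix x assume "x \<in> set ((s, 0) # map up xs)"
      then consider "x = (s, 0)" | y where "y \<in> set xs" "x = up y" by auto
      then show "x \<in> {x \<in> S \<times> UNIV. ring_time \<omega> x \<le> t}"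
      proof cases
        case 1
        then show ?thesis using s t by (simp add: ring_time_def \<tau>_def)
      next
        case 2
        then have "y \<in> S \<times> UNIV" "ring_time \<omega>' y \<le> t - \<tau>" using setxs by auto
        then show ?thesis using rt[of y] 2 by (auto simp: up_def)
      qed
    next
      fix x assume x: "x \<in> {x \<in> S \<times> UNIV. ring_time \<omega> x \<le> t}"
      show "x \<in> set ((s, 0) # map up xs)"
      proof (cases "x = (s, 0)")
        case False
        \<comment> \<open>The preimage under \<open>up\<close>. As \<open>x\<close> is not
          \<open>(s, 0)\<close>, the subtraction does not truncate.\<close>
        define y where "y = (fst x, if fst x = s then snd x - 1 else snd x)"
        have "up y = x" using False by (cases x) (auto simp: up_def y_def)
        moreover have "y \<in> S \<times> UNIV" using x by (auto simp: y_def)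
        ultimately have "y \<in> set xs" using rt[of y] x unfolding setxs by auto
        then show ?thesis using \<open>up y = x\<close> by auto
      qed simp
    qed
    have "\<tau> < ring_time \<omega> (up y)" if "y \<in> set xs" for y
    proof -
      have y: "y \<in> S \<times> UNIV" using that setxs by auto
      then have "0 < \<omega>' (fst y, 0)" by (intro pos) auto
      also have "\<dots> \<le> ring_time \<omega>' y" by (rule first_wait_le_ring_time[OF pos y])
      finally show ?thesis using rt[OF y] by simp
    qed
    moreover have "ring_time \<omega> (s, 0) = \<tau>" by (simp add: ring_time_def \<tau>_def)
    moreover have "sorted_wrt (\<lambda>x y. ring_time \<omega> (up x) < ring_time \<omega> (up y)) xs"
    proof (rule sorted_wrt_mono_rel)
      show "sorted_wrt (\<lambda>x y. ring_time \<omega>' x < ring_time \<omega>' y) xs" using xs by (simp add: chronological_def)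
      show "ring_time \<omega> (up x) < ring_time \<omega> (up y)"
        if "x \<in> set xs" "y \<in> set xs" "ring_time \<omega>' x < ring_time \<omega>' y" for x y
        using that rt[of x] rt[of y] setxs by auto
    qed
    ultimately show "sorted_wrt (\<lambda>x y. ring_time \<omega> x < ring_time \<omega> y) ((s, 0) # map up xs)"
      by (simp add: sorted_wrt_map)
  qed
  moreover have "map fst ((s, 0) # map up xs) = s # w" using xs by (auto simp: up_def o_def)
  ultimately show ?case by (intro exI conjI)
qed

lemma AE_wait_pos: "AE \<omega> in clocks. \<forall>x\<in>S \<times> UNIV. 0 < \<omega> x"
proof (subst AE_ball_countable)
  show "countable (S \<times> (UNIV :: nat set))" using finite_S by (intro countable_SIGMA) (auto intro: countable_finite)
  show "\<forall>x\<in>S \<times> UNIV. AE \<omega> in clocks. 0 < \<omega> x"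
  proof
    fix x assume x: "x \<in> S \<times> (UNIV :: nat set)"
    have "AE y in lborel. y \<noteq> (0::real)" by (rule AE_lborel_singleton)
    then have "AE y in wtime x. 0 < y"
      by (subst AE_density) (auto simp: exponential_density_def)
    then show "AE \<omega> in clocks. 0 < \<omega> x" by (rule AE_component[OF x])
  qed
qed

text \<open>Only countably many lists are candidates and at most one fits, so measurability reduces
  to the event for a fixed list, a countable combination of comparisons of ring times.\<close>

lemma measurable_chronological:
  "(\<lambda>\<omega>. THE xs. chronological t \<omega> xs) \<in> clocks \<rightarrow>\<^sub>M count_space UNIV"
proof (rule measurable_THE)
  have rt [measurable]: "(\<lambda>\<omega>. ring_time \<omega> x) \<in> borel_measurable clocks" if "x \<in> S \<times> UNIV" for x
    using that by (cases x) (auto simp: ring_time_def intro!: borel_measurable_sum)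
  show "countable (lists (S \<times> (UNIV :: nat set)))"
    using finite_S by (intro countable_lists countable_SIGMA) (auto intro: countable_finite)
  show "xs \<in> lists (S \<times> UNIV)" if "chronological t \<omega> xs" for xs \<omega>
    using that by (auto simp: chronological_def in_lists_conv_set)
  show "xs = ys" if "chronological t \<omega> xs" "chronological t \<omega> ys" for xs ys \<omega>
    using that by (rule chronological_unique)
  fix xs :: "('a \<times> nat) list"
  show "Measurable.pred clocks (\<lambda>\<omega>. chronological t \<omega> xs)"
  proof (cases "set xs \<subseteq> S \<times> UNIV")
    case True
    have eq: "chronological t \<omega> xs \<longleftrightarrow> (\<forall>s\<in>S. \<forall>k. ring_time \<omega> (s, k) \<le> t \<longleftrightarrow> (s, k) \<in> set xs) \<and>
        (\<forall>i\<in>{..<length xs}. \<forall>j\<in>{..<length xs}. i < j \<longrightarrow> ring_time \<omega> (xs ! i) < ring_time \<omega> (xs ! j))" for \<omega>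
      using True by (auto simp: chronological_def sorted_wrt_iff_nth_less)
    have [measurable]: "Measurable.pred clocks (\<lambda>\<omega>. \<forall>s\<in>S. \<forall>k. ring_time \<omega> (s, k) \<le> t \<longleftrightarrow> (s, k) \<in> set xs)"
    proof (intro pred_intros_finite(3)[OF finite_S] pred_intros_countable(1))
      fix s and k :: nat assume "s \<in> S"
      then have [measurable]: "(s, k) \<in> S \<times> UNIV" by simp
      show "Measurable.pred clocks (\<lambda>\<omega>. ring_time \<omega> (s, k) \<le> t \<longleftrightarrow> (s, k) \<in> set xs)" by measurable
    qed
    have [measurable]: "xs ! i \<in> S \<times> UNIV" if "i \<in> {..<length xs}" for i
      using True that nth_mem by blast
    have [measurable]: "Measurable.pred clocks
        (\<lambda>\<omega>. \<forall>i\<in>{..<length xs}. \<forall>j\<in>{..<length xs}. i < j \<longrightarrow> ring_time \<omega> (xs ! i) < ring_time \<omega> (xs ! j))"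
    proof (rule pred_intros_finite(3), simp, rule pred_intros_finite(3), simp)
      fix i j assume [measurable]: "i \<in> {..<length xs}" "j \<in> {..<length xs}"
      have "Measurable.pred clocks (\<lambda>\<omega>. ring_time \<omega> (xs ! i) < ring_time \<omega> (xs ! j))" by measurable
      then show "Measurable.pred clocks (\<lambda>\<omega>. i < j \<longrightarrow> ring_time \<omega> (xs ! i) < ring_time \<omega> (xs ! j))"
        by (cases "i < j") simp_all
    qed
    show ?thesis unfolding eq by measurable
  next
    case False
    then have "\<not> chronological t \<omega> xs" for \<omega> by (auto simp: chronological_def)
    then show ?thesis by simp
  qed
qed

section \<open>Distribution of the label word\<close>

definition labels :: "real \<Rightarrow> ('a \<times> nat \<Rightarrow> real) \<Rightarrow> 'a list" where
  "labels t \<omega> = map fst (THE xs. chronological t \<omega> xs)"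

lemma measurable_labels [measurable]: "labels t \<in> clocks \<rightarrow>\<^sub>M count_space UNIV"
  unfolding labels_def by (rule measurable_compose[OF measurable_chronological]) simp

text \<open>This inequality for \<open>Q\<close> and for its complement suffices, since both sides have total mass \<open>1\<close>;
  almost sure existence of the chronological list comes out as a by-product.\<close>

lemma measure_labels_ge:
  assumes "0 \<le> t" "Q \<subseteq> lists S"
  shows "summable (\<lambda>n. exp (- t * sum r S) * (t ^ n / fact n) * (\<Sum>w | w \<in> Q \<and> length w = n. prod_list (map r w)))" (is "summable ?f")
    and "(\<Sum>n. exp (- t * sum r S) * (t ^ n / fact n) * (\<Sum>w | w \<in> Q \<and> length w = n. prod_list (map r w)))
    \<le> measure clocks {\<omega> \<in> space clocks. labels t \<omega> \<in> Q}"
proof -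
  define B where "B w = {\<omega> \<in> space clocks. labels t \<omega> = w}" for w
  have B [measurable]: "B w \<in> sets clocks" for w unfolding B_def by measurable
  define p where "p w = prod_list (map r w) * (t ^ length w / fact (length w)) * exp (- t * sum r S)" for w
  \<comment> \<open>On the event \<open>rings_word w t\<close> the labels are \<open>w\<close> as
    soon as all waits are positive, hence almost surely. This one inclusion yields the
    inequality.\<close>
  have pB: "p w \<le> measure clocks (B w)" if "w \<in> Q" for w
  proof -
    have w: "set w \<subseteq> S" using that assms by auto
    have "0 \<le> p w" unfolding p_def using assms rate_pos
      by (intro mult_nonneg_nonneg prod_list_nonneg) (auto intro: less_imp_le)
    then have "p w = measure clocks {\<omega> \<in> space clocks. rings_word w t \<omega>}"
      using emeasure_rings_word[OF w assms(1)] by (simp add: measure_def p_def)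
    also have "\<dots> \<le> measure clocks (B w)"
    proof (rule P.finite_measure_mono_AE)
      show "AE \<omega> in clocks. \<omega> \<in> {\<omega> \<in> space clocks. rings_word w t \<omega>} \<longrightarrow> \<omega> \<in> B w"
        using AE_wait_pos
      proof eventually_elim
        case (elim \<omega>)
        show ?case
        proof
          assume "\<omega> \<in> {\<omega> \<in> space clocks. rings_word w t \<omega>}"
          then have ww: "\<omega> \<in> space clocks" "rings_word w t \<omega>" by auto
          with chronological_rings_word[OF w _ ww(2)] elim obtain xs where "chronological t \<omega> xs" "map fst xs = w"
            by blast
          moreover have "(THE xs. chronological t \<omega> xs) = xs"
            using \<open>chronological t \<omega> xs\<close> chronological_unique by blast
          ultimately show "\<omega> \<in> B w" using ww by (simp add: B_def labels_def)
        qed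
      qed
    qed measurable
    finally show ?thesis .
  qed
  let ?W = "\<lambda>n. {w. w \<in> Q \<and> length w = n}"
  have finW: "finite (?W n)" for n
    by (rule finite_subset[OF _ finite_lists_length_eq[OF finite_S, of n]]) (use assms in auto)
  have fp: "?f n = (\<Sum>w\<in>?W n. p w)" for n
    by (auto simp: p_def sum_distrib_left intro!: sum.cong)
  \<comment> \<open>Collects the words by length; these events are disjoint, so the bounds can be
    summed over \<open>n\<close>.\<close>
  define A where "A n = (\<Union>w\<in>?W n. B w)" for n
  have A [measurable]: "A n \<in> sets clocks" for n unfolding A_def using finW by auto
  have fA: "?f n \<le> measure clocks (A n)" for n
  proof -
    have "measure clocks (A n) = (\<Sum>w\<in>?W n. measure clocks (B w))"
      unfolding A_def using finW
      by (intro P.finite_measure_finite_Union) (auto simp: disjoint_family_on_def B_def)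
    moreover have "(\<Sum>w\<in>?W n. p w) \<le> (\<Sum>w\<in>?W n. measure clocks (B w))" by (intro sum_mono pB) simp
    ultimately show ?thesis unfolding fp by simp
  qed
  have "(\<lambda>n. measure clocks (A n)) sums measure clocks (\<Union>n. A n)"
    using A by (intro P.finite_measure_UNION) (auto simp: disjoint_family_on_def A_def[abs_def] B_def)
  moreover have "(\<Union>n. A n) = {\<omega> \<in> space clocks. labels t \<omega> \<in> Q}"
    by (auto simp: A_def B_def)
  ultimately have sA: "(\<lambda>n. measure clocks (A n)) sums measure clocks {\<omega> \<in> space clocks. labels t \<omega> \<in> Q}" by simp
  have "0 \<le> ?f n" for n using assms rate_pos
    by (intro mult_nonneg_nonneg sum_nonneg prod_list_nonneg) (auto intro: less_imp_le)
  then have "norm (?f n) \<le> measure clocks (A n)" for n using fA[of n] by (simp only: real_norm_def abs_of_nonneg)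
  then show s: "summable ?f"
    by (intro summable_comparison_test'[OF sums_summable[OF sA], of 0])
  show "suminf ?f \<le> measure clocks {\<omega> \<in> space clocks. labels t \<omega> \<in> Q}"
    using suminf_le[OF fA s sums_summable[OF sA]] sums_unique[OF sA] by simp
qed

text \<open>With L the total rate, the lower bounds for \<open>Q\<close> and its complement sum to
  exp (-t L) exp (t L) = 1, as do the two probabilities, so neither bound can be strict.\<close>

lemma measure_labels_sums:
  assumes "0 \<le> t"
  shows "(\<lambda>n. exp (- t * sum r S) * (t ^ n / fact n) *
      (\<Sum>w | set w \<subseteq> S \<and> length w = n. if Q w then prod_list (map r w) else 0))
    sums measure clocks {\<omega> \<in> space clocks. Q (labels t \<omega>)}"
proof -
  let ?c = "\<lambda>n. exp (- t * sum r S) * (t ^ n / fact n)"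
  define f where "f X n = ?c n * (\<Sum>w | w \<in> X \<and> length w = n. prod_list (map r w))" for X n
  have [measurable]: "Measurable.pred clocks (\<lambda>\<omega>. Q (labels t \<omega>))"
    by (rule measurable_compose[OF measurable_labels]) simp
  define Q1 where "Q1 = {w \<in> lists S. Q w}"
  define Q2 where "Q2 = {w \<in> lists S. \<not> Q w}"
  have Q: "Q1 \<subseteq> lists S" "Q2 \<subseteq> lists S" by (auto simp: Q1_def Q2_def)
  note ge1 = measure_labels_ge[OF assms Q(1), folded f_def]
  note ge2 = measure_labels_ge[OF assms Q(2), folded f_def]
  have fin: "finite {w. w \<in> X \<and> length w = n}" if "X \<subseteq> lists S" for X n
    by (rule finite_subset[OF _ finite_lists_length_eq[OF finite_S, of n]]) (use that in auto)
  have add: "f Q1 n + f Q2 n = exp (- t * sum r S) * ((t * sum r S) ^ n /\<^sub>R fact n)" for n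
  proof -
    have "(\<Sum>w | w \<in> Q1 \<and> length w = n. prod_list (map r w)) + (\<Sum>w | w \<in> Q2 \<and> length w = n. prod_list (map r w))
        = (\<Sum>w \<in> {w. w \<in> Q1 \<and> length w = n} \<union> {w. w \<in> Q2 \<and> length w = n}. prod_list (map r w))"
      by (rule sum.union_disjoint[symmetric, OF fin[OF Q(1)] fin[OF Q(2)]]) (auto simp: Q1_def Q2_def)
    also have "{w. w \<in> Q1 \<and> length w = n} \<union> {w. w \<in> Q2 \<and> length w = n} = {w. set w \<subseteq> S \<and> length w = n}"
      by (auto simp: Q1_def Q2_def)
    finally show ?thesis
      by (simp add: f_def sum_prod_list_words[OF finite_S] power_mult_distrib divide_simps algebra_simps)
        (simp add: distrib_left[symmetric] mult.assoc[symmetric])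
  qed
  have "(\<lambda>n. exp (- t * sum r S) * ((t * sum r S) ^ n /\<^sub>R fact n)) sums (exp (- t * sum r S) * exp (t * sum r S))"
    by (intro sums_mult exp_converges)
  then have "(\<lambda>n. f Q1 n + f Q2 n) sums 1" by (simp add: add exp_add[symmetric])
  then have "suminf (f Q1) + suminf (f Q2) = 1"
    using sums_unique suminf_add[OF ge1(1) ge2(1)] by metis
  moreover have "measure clocks {\<omega> \<in> space clocks. labels t \<omega> \<in> Q1} \<le> measure clocks {\<omega> \<in> space clocks. Q (labels t \<omega>)}"
    by (intro P.finite_measure_mono) (auto simp: Q1_def)
  moreover have "measure clocks {\<omega> \<in> space clocks. labels t \<omega> \<in> Q2} \<le> measure clocks {\<omega> \<in> space clocks. \<not> Q (labels t \<omega>)}"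
    by (intro P.finite_measure_mono) (auto simp: Q2_def)
  moreover have "measure clocks {\<omega> \<in> space clocks. \<not> Q (labels t \<omega>)} = 1 - measure clocks {\<omega> \<in> space clocks. Q (labels t \<omega>)}"
    by (intro P.prob_neg) measurable
  ultimately have "suminf (f Q1) = measure clocks {\<omega> \<in> space clocks. Q (labels t \<omega>)}"
    using ge1(2) ge2(2) by linarith
  with ge1(1) have "f Q1 sums measure clocks {\<omega> \<in> space clocks. Q (labels t \<omega>)}"
    by (metis summable_sums)
  moreover have "f Q1 n = ?c n * (\<Sum>w | set w \<subseteq> S \<and> length w = n. if Q w then prod_list (map r w) else 0)" for n
    unfolding f_def by (rule arg_cong[where f = "\<lambda>x. ?c n * x"], rule sum.mono_neutral_cong_left)
      (auto simp: finite_lists_length_eq[OF finite_S] Q1_def)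
  ultimately show ?thesis by (simp cong: sums_cong)
qed

end

text \<open>Reduces the Poisson-clock definition to algebra: the position at time \<open>t\<close>
  depends on the clocks only through the label word, whose law is
  \<open>measure_labels_sums\<close>.\<close>

lemma walk_prob_sums:
  assumes fin: "finite (rate_support G rate)" and "0 \<le> t"
  shows "(\<lambda>n. exp (- t * sum rate (rate_support G rate)) * (t ^ n / fact n) *
      (\<Sum>w | set w \<subseteq> rate_support G rate \<and> length w = n.
        if foldl (\<otimes>\<^bsub>G\<^esub>) \<one>\<^bsub>G\<^esub> w = g then prod_list (map rate w) else 0))
    sums walk_prob G rate t g"
proof -
  define S where "S = rate_support G rate"
  \<comment> \<open>Total rates, since the product-measure locale wants every factor to be a probability space.\<close>
  define r where "r s = (if s \<in> S then rate s else 1)" for s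
  interpret poisson_clocks S r
    by unfold_locales (use fin in \<open>auto simp: S_def r_def rate_support_def\<close>)
  have clk: "clock_space G rate = clocks"
    unfolding clock_space_def S_def[symmetric] by (rule PiM_cong) (auto simp: r_def)
  have walk: "random_walk G rate t \<omega> = foldl (\<otimes>\<^bsub>G\<^esub>) \<one>\<^bsub>G\<^esub> (labels t \<omega>)" for \<omega>
    unfolding random_walk_def rings_upto_def S_def[symmetric] labels_def chronological_def by simp
  have sr: "sum r S = sum rate S" by (simp add: r_def)
  have pr: "prod_list (map r w) = prod_list (map rate w)" if "set w \<subseteq> S" for w
    using that by (auto simp: r_def subset_iff cong: map_cong)
  have "(\<Sum>w | set w \<subseteq> S \<and> length w = n. if Q w then prod_list (map r w) else 0)
      = (\<Sum>w | set w \<subseteq> S \<and> length w = n. if Q w then prod_list (map rate w) else 0)" for n Q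
    by (intro sum.cong refl) (auto simp: pr)
  then show ?thesis
    using measure_labels_sums[OF assms(2), of "\<lambda>w. foldl (\<otimes>\<^bsub>G\<^esub>) \<one>\<^bsub>G\<^esub> w = g"]
    unfolding walk_prob_def clk walk by (simp only: S_def[symmetric] sr)
qed

section \<open>Fourier analysis on the dihedral group\<close>

definition chi :: "nat \<Rightarrow> int \<Rightarrow> int \<Rightarrow> complex" where
  "chi n k x = cis (2 * pi * of_int k * of_int x / real n)"

lemma chi_add: "chi n k (x + y) = chi n k x * chi n k y"
  by (simp add: chi_def cis_mult ring_distribs add_divide_distrib)

lemma chi_0 [simp]: "chi n k 0 = 1"
  by (simp add: chi_def)

lemma chi_minus: "chi n k (- x) = cnj (chi n k x)"
  by (simp add: chi_def cis_cnj)

lemma chi_diff: "chi n k (x - y) = chi n k x * cnj (chi n k y)"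
  using chi_add[of n k x "- y"] by (simp add: chi_minus)

text \<open>Lets facts about positions, such as \<open>chi_add\<close> and \<open>chi_sum\<close>,
  be reused for frequencies.\<close>

lemma chi_commute: "chi n k x = chi n x k"
  by (simp add: chi_def mult_ac)

lemma chi_mult_eq_1: "chi n k (int n * x) = 1"
proof (cases "n = 0")
  case False
  then have "2 * pi * of_int k * of_int (int n * x) / real n = 2 * pi * of_int (k * x)"
    by (simp add: field_simps)
  then show ?thesis unfolding chi_def by (simp only: cis_multiple_2pi Ints_of_int)
qed simp

lemma chi_mod: "chi n k (x mod int n) = chi n k x"
proof -
  have "chi n k x = chi n k (int n * (x div int n) + x mod int n)" by simp
  also have "\<dots> = chi n k (x mod int n)" by (simp only: chi_add chi_mult_eq_1 mult_1_left)
  finally show ?thesis by simp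
qed

lemma chi_eq_1_iff:
  assumes "0 < n"
  shows "chi n 1 x = 1 \<longleftrightarrow> int n dvd x"
proof
  assume "int n dvd x"
  then show "chi n 1 x = 1" using chi_mult_eq_1[of n 1] by (auto elim!: dvdE)
next
  assume "chi n 1 x = 1"
  then have "cos (2 * pi * of_int x / real n) = 1"
    unfolding chi_def by (metis cis.sel(1) mult.right_neutral of_int_1 one_complex.sel(1))
  then obtain m :: int where "2 * pi * of_int x / real n = of_int m * 2 * pi"
    using cos_one_2pi_int by blast
  then have "(of_int x :: real) = of_int (m * int n)" using assms by (simp add: field_simps)
  then have "x = m * int n" by (simp only: of_int_eq_iff)
  then show "int n dvd x" by simp
qed

text \<open>Orthogonality of characters, from the geometric sum over the powers of an n-th root of
  unity.\<close>

lemma chi_sum: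
  assumes "0 < n"
  shows "(\<Sum>k\<in>{0..<int n}. chi n k x) = (if int n dvd x then of_nat n else 0)"
proof -
  have pow: "chi n (int k) x = chi n 1 x ^ k" for k
    unfolding chi_def Complex.DeMoivre by (rule arg_cong[where f = cis]) simp
  have "(\<Sum>k\<in>{0..<int n}. chi n k x) = (\<Sum>k<n. chi n 1 x ^ k)"
    by (rule sum.reindex_bij_witness[of _ int nat]) (auto simp: pow[symmetric])
  also have "\<dots> = (if int n dvd x then of_nat n else 0)"
  proof (cases "int n dvd x")
    case True
    then have "chi n 1 x = 1" using chi_eq_1_iff[OF assms] by simp
    then show ?thesis using True by simp
  next
    case False
    then have "chi n 1 x \<noteq> 1" using chi_eq_1_iff[OF assms] by simp
    moreover have "chi n 1 x ^ n = 1"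
      using pow[of n] chi_mult_eq_1[of n x 1] by (simp add: chi_commute[of n "int n"])
    ultimately show ?thesis using False by (simp add: geometric_sum)
  qed
  finally show ?thesis .
qed

section \<open>Walks driven by reflections\<close>

definition reflection_rates :: "(int \<Rightarrow> real) \<Rightarrow> int \<times> bool \<Rightarrow> real" where
  "reflection_rates l = (\<lambda>(x, a). if a then l x else 0)"

definition rate_transform :: "nat \<Rightarrow> (int \<Rightarrow> real) \<Rightarrow> int \<Rightarrow> complex" where
  "rate_transform n l k = (\<Sum>x\<in>{0..<int n}. of_real (l x) * chi n k x)"

context
  fixes n :: nat and l :: "int \<Rightarrow> real"
  assumes n: "0 < n" and l_pos: "\<And>x. x \<in> {0..<int n} \<Longrightarrow> 0 < l x"
begin

lemma reflection_support: "rate_support (dihedral n) (reflection_rates l) = {0..<int n} \<times> {True}"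
  using l_pos by (auto simp: rate_support_def dihedral_def reflection_rates_def split: if_splits)

lemma rate_collection_reflection: "rate_collection (dihedral n) (reflection_rates l)"
  using l_pos by (auto simp: rate_collection_def dihedral_def reflection_rates_def less_imp_le)

text \<open>Reflections are their own inverses and rotations carry rate 0, so symmetry holds even
  for an \<open>l\<close> that is not even in x. This leaves room for transforms with complex
  values.\<close>

lemma symmetric_rates_reflection: "symmetric_rates (dihedral n) (reflection_rates l)"
proof -
  interpret group "dihedral n" using n by (rule group_dihedral)
  have "reflection_rates l (i, a) = reflection_rates l (inv\<^bsub>dihedral n\<^esub> (i, a))"
    if ia: "(i, a) \<in> carrier (dihedral n)" for i a
  proof (cases a)
    case True
    have "inv\<^bsub>dihedral n\<^esub> (i, a) = (i, a)"
      using ia True by (intro inv_equality) (auto simp: dihedral_def)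
    then show ?thesis by simp
  next
    case False
    have "inv\<^bsub>dihedral n\<^esub> (i, a) = ((- i) mod int n, False)"
      using ia False n by (intro inv_equality) (auto simp: dihedral_def mod_simps)
    then show ?thesis using False by (simp add: reflection_rates_def)
  qed
  then show ?thesis by (force simp: symmetric_rates_def)
qed

lemma generating_rates_reflection: "generating_rates (dihedral n) (reflection_rates l)"
proof -
  interpret group "dihedral n" using n by (rule group_dihedral)
  let ?S = "{0..<int n} \<times> {True}"
  have sub: "?S \<subseteq> carrier (dihedral n)" by (auto simp: dihedral_def)
  have "carrier (dihedral n) \<subseteq> generate (dihedral n) ?S"
  proof
    fix g assume g: "g \<in> carrier (dihedral n)"
    obtain i a where ia: "g = (i, a)" by (cases g)
    have i: "0 \<le> i" "i < int n" using g by (auto simp: ia dihedral_def)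
    show "g \<in> generate (dihedral n) ?S"
    proof (cases a)
      case True
      then show ?thesis using i by (auto simp: ia intro!: generate.incl)
    next
      case False
      have "(i, True) \<otimes>\<^bsub>dihedral n\<^esub> (0, True) \<in> generate (dihedral n) ?S"
        using i n by (intro generate.eng generate.incl) auto
      then show ?thesis using i False by (simp add: ia dihedral_def)
    qed
  qed
  then show ?thesis
    using generate_incl[OF sub] unfolding generating_rates_def reflection_support by blast
qed

text \<open>Each letter switches the coset and moves the position forwards from a rotation,
  backwards from a reflection. It thus contributes \<gamma> or its conjugate, in alternation: pairs
  give the squared modulus, and an odd number of letters leaves one factor whose phase is fixed by
  the final coset \<open>a\<close>. For \<gamma> = 0 the convention \<open>sgn 0 = 0\<close> is
  consistent, as the modulus vanishes too.\<close>

lemma words_transform: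
  "(\<Sum>w | set w \<subseteq> {0..<int n} \<times> {True} \<and> length w = N. of_real (prod_list (map (reflection_rates l) w)) *
      (case foldl (\<otimes>\<^bsub>dihedral n\<^esub>) (y, b) w of (z, c) \<Rightarrow> if c = a then chi n k z else 0))
   = (if (b = a) = even N then of_real (norm (rate_transform n l k) ^ N) * chi n k y *
       (if even N then 1 else if a then sgn (rate_transform n l k) else cnj (sgn (rate_transform n l k))) else 0)"
proof (induction N arbitrary: y b)
  case 0
  have "{w. set w \<subseteq> {0..<int n} \<times> {True} \<and> length w = 0} = {[]}" by auto
  then show ?case by simp
next
  case (Suc N)
  define \<gamma> where "\<gamma> = rate_transform n l k"
  define c where "c M = (if even M then 1 else if a then sgn \<gamma> else cnj (sgn \<gamma>))" for M :: nat
  have \<gamma>_cnj: "cnj \<gamma> = (\<Sum>x\<in>{0..<int n}. of_real (l x) * cnj (chi n k x))"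
    by (simp add: \<gamma>_def rate_transform_def)
  have sgn: "of_real (norm \<gamma>) * sgn \<gamma> = \<gamma>"
    by (cases "\<gamma> = 0") (simp_all add: sgn_div_norm scaleR_conv_of_real)
  have sgn_cnj: "of_real (norm \<gamma>) * cnj (sgn \<gamma>) = cnj \<gamma>"
    by (metis sgn complex_cnj_mult complex_cnj_complex_of_real)
  have norm_sq: "\<gamma> * cnj \<gamma> = of_real (norm \<gamma>) * of_real (norm \<gamma>)"
    by (metis complex_norm_square power2_eq_square of_real_mult)
  have sgn_mult: "sgn \<gamma> * cnj \<gamma> = of_real (norm \<gamma>)" "cnj (sgn \<gamma>) * \<gamma> = of_real (norm \<gamma>)"
    using norm_sq sgn sgn_cnj by (cases "\<gamma> = 0"; simp add: sgn_div_norm scaleR_conv_of_real divide_simps mult_ac)+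
  have fin: "finite ({0..<int n} \<times> {True})" by simp
  have step: "foldl (\<otimes>\<^bsub>dihedral n\<^esub>) (y, b) ((x, True) # w)
      = foldl (\<otimes>\<^bsub>dihedral n\<^esub>) ((if b then y - x else y + x) mod int n, \<not> b) w" for x w
    by (simp add: dihedral_def)
  have "(\<Sum>w | set w \<subseteq> {0..<int n} \<times> {True} \<and> length w = Suc N. of_real (prod_list (map (reflection_rates l) w)) *
      (case foldl (\<otimes>\<^bsub>dihedral n\<^esub>) (y, b) w of (z, c) \<Rightarrow> if c = a then chi n k z else 0))
    = (\<Sum>s\<in>{0..<int n} \<times> {True}. \<Sum>w | set w \<subseteq> {0..<int n} \<times> {True} \<and> length w = N.
        of_real (prod_list (map (reflection_rates l) (s # w))) *
      (case foldl (\<otimes>\<^bsub>dihedral n\<^esub>) (y, b) (s # w) of (z, c) \<Rightarrow> if c = a then chi n k z else 0))"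
    by (rule sum_words_Suc[OF fin])
  also have "\<dots> = (\<Sum>x\<in>{0..<int n}. \<Sum>w | set w \<subseteq> {0..<int n} \<times> {True} \<and> length w = N.
        of_real (prod_list (map (reflection_rates l) ((x, True) # w))) *
      (case foldl (\<otimes>\<^bsub>dihedral n\<^esub>) (y, b) ((x, True) # w) of (z, c) \<Rightarrow> if c = a then chi n k z else 0))"
    by (rule sum.reindex_bij_witness[of _ "\<lambda>x. (x, True)" fst]) auto
  \<comment> \<open>The induction hypothesis applies at the new position in the opposite coset; the
    reduction modulo n disappears under \<open>chi\<close>.\<close>
  also have "\<dots> = (\<Sum>x\<in>{0..<int n}. of_real (l x) *
      (if (\<not> b = a) = even N then of_real (norm \<gamma> ^ N) * chi n k (if b then y - x else y + x) * c N else 0))"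
    unfolding step
    by (intro sum.cong refl)
      (simp add: reflection_rates_def mult.assoc sum_distrib_left[symmetric] Suc.IH[unfolded reflection_rates_def] chi_mod \<gamma>_def c_def)
  also have "\<dots> = (if (\<not> b = a) = even N then of_real (norm \<gamma> ^ N) * chi n k y * c N *
      (\<Sum>x\<in>{0..<int n}. of_real (l x) * (if b then cnj (chi n k x) else chi n k x)) else 0)"
    by (cases b) (auto simp: sum_distrib_left chi_add chi_diff mult_ac intro!: sum.cong)
  also have "(\<Sum>x\<in>{0..<int n}. of_real (l x) * (if b then cnj (chi n k x) else chi n k x)) = (if b then cnj \<gamma> else \<gamma>)"
    by (simp add: \<gamma>_cnj) (simp add: \<gamma>_def rate_transform_def)
  also have "(if (\<not> b = a) = even N then of_real (norm \<gamma> ^ N) * chi n k y * c N * (if b then cnj \<gamma> else \<gamma>) else 0)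
     = (if (b = a) = even (Suc N) then of_real (norm \<gamma> ^ Suc N) * chi n k y * c (Suc N) else 0)"
    using sgn sgn_cnj sgn_mult by (cases "even N"; cases a; cases b; simp add: c_def mult_ac)
  finally show ?case by (simp only: c_def \<gamma>_def)
qed

text \<open>Fourier inversion in the rotation coordinate: the indicator of \<open>x\<close> is an
  average of characters, and \<open>words_transform\<close>, started at the identity, evaluates each
  frequency.\<close>

lemma dihedral_words_sum:
  assumes x: "x \<in> {0..<int n}"
  shows "complex_of_real (\<Sum>w | set w \<subseteq> {0..<int n} \<times> {True} \<and> length w = N.
      if foldl (\<otimes>\<^bsub>dihedral n\<^esub>) \<one>\<^bsub>dihedral n\<^esub> w = (x, a) then prod_list (map (reflection_rates l) w) else 0)
   = (\<Sum>k\<in>{0..<int n}. chi n k (- x) *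
       (if even N = (\<not> a) then of_real (norm (rate_transform n l k) ^ N) * (if a then sgn (rate_transform n l k) else 1) else 0)) / of_nat n"
proof -
  let ?D = "dihedral n"
  have carr: "fst (foldl (\<otimes>\<^bsub>?D\<^esub>) h w) \<in> {0..<int n}" if "fst h \<in> {0..<int n}" for h w
    using that
  proof (induction w arbitrary: h)
    case (Cons s w)
    have "fst (h \<otimes>\<^bsub>?D\<^esub> s) \<in> {0..<int n}" using n by (auto simp: dihedral_def split: prod.splits)
    then show ?case using Cons.IH by simp
  qed simp
  have ind: "(if g = (x, a) then 1 else 0)
      = (\<Sum>k\<in>{0..<int n}. chi n k (- x) * (case g of (z, c) \<Rightarrow> if c = a then chi n k z else 0)) / of_nat n"
    if "fst g \<in> {0..<int n}" for g
  proof (cases g)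
    case (Pair z c)
    have "int n dvd - x + z \<longleftrightarrow> z = x"
    proof
      assume "int n dvd - x + z"
      moreover have "\<bar>- x + z\<bar> < \<bar>int n\<bar>" using that x by (auto simp: Pair)
      ultimately show "z = x" using dvd_imp_le_int[of "- x + z" "int n"] by fastforce
    qed simp
    moreover have "(\<Sum>k\<in>{0..<int n}. chi n k (- x) * (if c = a then chi n k z else 0))
        = (if c = a then \<Sum>k\<in>{0..<int n}. chi n k (- x + z) else 0)"
      by (simp only: chi_add) (simp add: sum_distrib_left)
    ultimately show ?thesis
      using chi_sum[OF n, of "- x + z"] n by (auto simp: Pair)
  qed
  have one: "\<one>\<^bsub>?D\<^esub> = (0, False)" by (simp add: dihedral_def)
  let ?W = "{w. set w \<subseteq> {0..<int n} \<times> {True} \<and> length w = N}"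
  let ?p = "\<lambda>w. complex_of_real (prod_list (map (reflection_rates l) w))"
  let ?F = "\<lambda>k w. (case foldl (\<otimes>\<^bsub>?D\<^esub>) (0, False) w of (z, c) \<Rightarrow> if c = a then chi n k z else 0)"
  have "complex_of_real (\<Sum>w\<in>?W. if foldl (\<otimes>\<^bsub>?D\<^esub>) \<one>\<^bsub>?D\<^esub> w = (x, a) then prod_list (map (reflection_rates l) w) else 0)
      = (\<Sum>w\<in>?W. ?p w * (if foldl (\<otimes>\<^bsub>?D\<^esub>) (0, False) w = (x, a) then 1 else 0))"
    unfolding of_real_sum one by (intro sum.cong) auto
  also have "\<dots> = (\<Sum>w\<in>?W. ?p w * ((\<Sum>k\<in>{0..<int n}. chi n k (- x) * ?F k w) / of_nat n))"
    using n by (subst ind[OF carr]) auto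
  also have "\<dots> = (\<Sum>k\<in>{0..<int n}. chi n k (- x) * (\<Sum>w\<in>?W. ?p w * ?F k w)) / of_nat n"
    by (simp add: sum_distrib_left sum_divide_distrib sum.swap[of _ "?W"] mult_ac)
  finally show ?thesis
    unfolding words_transform by (auto intro!: sum.cong arg_cong2[where f = "(/)"])
qed

text \<open>Words of even length end on rotations and build the cosh series of the modulus; words of
  odd length end on reflections and build the sinh series, with the phase \<open>sgn\<close> left
  over.\<close>

lemma dihedral_walk_prob:
  assumes x: "x \<in> {0..<int n}"
  shows "complex_of_real (walk_prob (dihedral n) (reflection_rates l) 1 (x, False))
      = of_real (exp (- sum l {0..<int n}) / n) * (\<Sum>k\<in>{0..<int n}. chi n k (- x) * of_real (cosh (norm (rate_transform n l k))))"
    and "complex_of_real (walk_prob (dihedral n) (reflection_rates l) 1 (x, True))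
      = of_real (exp (- sum l {0..<int n}) / n) * (\<Sum>k\<in>{0..<int n}. chi n k (- x) *
          (of_real (sinh (norm (rate_transform n l k))) * sgn (rate_transform n l k)))"
proof -
  let ?D = "dihedral n" and ?g = "\<lambda>k. rate_transform n l k"
  have sup: "sum (reflection_rates l) ({0..<int n} \<times> {True}) = sum l {0..<int n}"
    by (rule sum.reindex_bij_witness[of _ "\<lambda>x. (x, True)" fst]) (auto simp: reflection_rates_def)
  let ?e = "exp (- sum l {0..<int n})"
  have main: "(\<lambda>N. of_real (?e / n) * (\<Sum>k\<in>{0..<int n}. chi n k (- x) *
       of_real (if even N = (\<not> a) then norm (?g k) ^ N /\<^sub>R fact N else 0) * (if a then sgn (?g k) else 1)))
      sums complex_of_real (walk_prob ?D (reflection_rates l) 1 (x, a))" for a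
  proof -
    have "finite (rate_support ?D (reflection_rates l))" by (simp add: reflection_support)
    from walk_prob_sums[OF this, of 1 "(x, a)"]
    have "(\<lambda>N. complex_of_real (?e * (1 / fact N) *
      (\<Sum>w | set w \<subseteq> {0..<int n} \<times> {True} \<and> length w = N.
        if foldl (\<otimes>\<^bsub>?D\<^esub>) \<one>\<^bsub>?D\<^esub> w = (x, a) then prod_list (map (reflection_rates l) w) else 0)))
      sums complex_of_real (walk_prob ?D (reflection_rates l) 1 (x, a))"
      unfolding reflection_support sup sums_of_real_iff by simp
    then show ?thesis
      unfolding of_real_mult dihedral_words_sum[OF x]
      by (rule back_subst[where P = "\<lambda>f. f sums _"])
        (auto simp: fun_eq_iff sum_distrib_left sum_divide_distrib divide_simps scaleR_conv_of_real intro!: sum.cong)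
  qed
  have "(\<lambda>N. of_real (?e / n) * (\<Sum>k\<in>{0..<int n}. chi n k (- x) *
       of_real (if even N then norm (?g k) ^ N /\<^sub>R fact N else 0)))
     sums (of_real (?e / n) * (\<Sum>k\<in>{0..<int n}. chi n k (- x) * complex_of_real (cosh (norm (?g k)))))"
    by (intro sums_mult sums_sum) (simp only: sums_of_real_iff cosh_converges)
  with main[of False] show "complex_of_real (walk_prob ?D (reflection_rates l) 1 (x, False))
      = of_real (?e / n) * (\<Sum>k\<in>{0..<int n}. chi n k (- x) * of_real (cosh (norm (?g k))))"
    by (intro sums_unique2) simp_all
  have "(\<lambda>N. of_real (?e / n) * (\<Sum>k\<in>{0..<int n}. chi n k (- x) *
       of_real (if even N then 0 else norm (?g k) ^ N /\<^sub>R fact N) * sgn (?g k)))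
     sums (of_real (?e / n) * (\<Sum>k\<in>{0..<int n}. chi n k (- x) * complex_of_real (sinh (norm (?g k))) * sgn (?g k)))"
    by (intro sums_mult sums_mult2 sums_sum) (simp only: sums_of_real_iff sinh_converges)
  moreover have "(if even N = (\<not> True) then y else 0) = (if even N then 0 else y)" for N :: nat and y :: real by simp
  ultimately show "complex_of_real (walk_prob ?D (reflection_rates l) 1 (x, True))
      = of_real (?e / n) * (\<Sum>k\<in>{0..<int n}. chi n k (- x) * (of_real (sinh (norm (?g k))) * sgn (?g k)))"
    using main[of True] by (intro sums_unique2) (simp_all only: mult.assoc if_True)
qed

end

section \<open>A negative cosine coefficient\<close>

lemma DERIV_abs_powr:
  fixes p y :: real
  assumes "1 < p"
  shows "((\<lambda>y. \<bar>y\<bar> powr p) has_real_derivative p * (sgn y * \<bar>y\<bar> powr (p - 1))) (at y)"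
proof (cases y "0 :: real" rule: linorder_cases)
  case greater
  have "((\<lambda>y. y powr p) has_real_derivative p * y powr (p - 1)) (at y)"
    using greater by (rule has_real_derivative_powr)
  moreover have "\<forall>\<^sub>F z in nhds y. \<bar>z\<bar> powr p = z powr p"
    using eventually_nhds_in_open[OF open_greaterThan, of y 0] greater by (auto elim!: eventually_mono)
  ultimately show ?thesis using greater by (subst DERIV_cong_ev[OF refl _ refl]) auto
next
  case less
  have "((\<lambda>y. (- y) powr p) has_real_derivative (p * (- y) powr (p - 1)) * (- 1)) (at y)"
    by (rule DERIV_chain2[OF has_real_derivative_powr]) (use less in \<open>auto intro!: derivative_eq_intros\<close>)
  moreover have "\<forall>\<^sub>F z in nhds y. \<bar>z\<bar> powr p = (- z) powr p"
    using eventually_nhds_in_open[OF open_lessThan, of y 0] less by (auto elim!: eventually_mono)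
  ultimately show ?thesis using less by (subst DERIV_cong_ev[OF refl _ refl]) auto
next
  case equal
  \<comment> \<open>The difference quotient at 0 is
    \<open>sgn h * \<bar>h\<bar> powr (p - 1)\<close>, which tends to 0 because p > 1.\<close>
  have "((\<lambda>h. \<bar>h\<bar> powr (p - 1)) \<longlongrightarrow> 0) (at (0::real))"
    using assms by (auto intro!: tendsto_eq_intros)
  then have "((\<lambda>h. sgn h * \<bar>h\<bar> powr (p - 1)) \<longlongrightarrow> 0) (at (0::real))"
    by (rule tendsto_0_le[where K = 1]) (auto simp: abs_mult sgn_real_def)
  moreover have "\<forall>\<^sub>F h in at (0::real). sgn h * \<bar>h\<bar> powr (p - 1) = (\<bar>0 + h\<bar> powr p - \<bar>0\<bar> powr p) / h"
    by (auto simp: eventually_at_filter powr_diff sgn_real_def divide_simps intro!: always_eventually)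
  ultimately show ?thesis
    using equal unfolding DERIV_def by (auto elim: Lim_transform_eventually)
qed

text \<open>The jump of \<open>sgn\<close> at 0 is absorbed by the power, as q > 0.\<close>

lemma continuous_on_sgn_abs_powr:
  fixes q :: real and f :: "'a::topological_space \<Rightarrow> real"
  assumes "0 < q" "continuous_on A f"
  shows "continuous_on A (\<lambda>x. sgn (f x) * \<bar>f x\<bar> powr q)"
proof -
  have "continuous (at y) (\<lambda>y. sgn y * \<bar>y\<bar> powr q)" for y :: real
  proof (cases "y = 0")
    case True
    have "((\<lambda>h. \<bar>h\<bar> powr q) \<longlongrightarrow> 0) (at (0::real))"
      using assms by (auto intro!: tendsto_eq_intros)
    then have "((\<lambda>h. sgn h * \<bar>h\<bar> powr q) \<longlongrightarrow> 0) (at (0::real))"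
      by (rule tendsto_0_le[where K = 1]) (auto simp: abs_mult sgn_real_def)
    then show ?thesis using True by (simp add: isCont_def)
  next
    case False
    have "\<forall>\<^sub>F z in nhds y. sgn z = sgn y"
    proof (cases "0 < y")
      case True
      then show ?thesis using eventually_nhds_in_open[OF open_greaterThan, of y 0] by (auto elim!: eventually_mono)
    next
      case F: False
      with False show ?thesis using eventually_nhds_in_open[OF open_lessThan, of y 0] by (auto elim!: eventually_mono)
    qed
    then have "isCont (\<lambda>z. sgn z * \<bar>z\<bar> powr q) y = isCont (\<lambda>z. sgn y * \<bar>z\<bar> powr q) y"
      by (intro isCont_cong) (auto elim!: eventually_mono)
    then show ?thesis using False by (auto intro!: continuous_intros)
  qed
  then have "continuous_on UNIV (\<lambda>y::real. sgn y * \<bar>y\<bar> powr q)" by (simp add: continuous_at_imp_continuous_on)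
  from continuous_on_compose2[OF this assms(2)] show ?thesis by simp
qed

lemma riemann_sums_tendsto:
  fixes f :: "real \<Rightarrow> real"
  assumes f: "continuous_on {0..c} f" and c: "0 < c"
  shows "(\<lambda>n. c / real n * (\<Sum>x<n. f (c * real x / real n))) \<longlonglongrightarrow> integral {0..c} f"
proof (rule LIMSEQ_I)
  fix e :: real assume e: "0 < e"
  have "uniformly_continuous_on {0..c} f" using f by (rule compact_uniformly_continuous) simp
  \<comment> \<open>With this oscillation on each mesh interval, the error over the total length
    \<open>c\<close> is at most \<open>e / 2\<close>.\<close>
  moreover have "0 < e / (2 * c)" using e c by simp
  ultimately obtain d where d: "0 < d"
    and uc: "\<And>x y. x \<in> {0..c} \<Longrightarrow> y \<in> {0..c} \<Longrightarrow> dist y x < d \<Longrightarrow> dist (f y) (f x) < e / (2 * c)"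
    unfolding uniformly_continuous_on_def by blast
  obtain N :: nat where N: "c / d < real N" using reals_Archimedean2 by blast
  have "norm (c / real n * (\<Sum>x<n. f (c * real x / real n)) - integral {0..c} f) < e" if n: "N < n" for n
  proof -
    define h where "h = c / real n"
    have n0: "0 < real n" using n by simp
    have h0: "0 < h" using c n0 by (simp add: h_def)
    have "c / d < real n" using N n by simp
    then have hd: "h < d" using n0 d by (simp add: h_def field_simps)
    have hn: "h * real n = c" using n0 by (simp add: h_def)
    have le: "h * real m \<le> c" if "m \<le> n" for m
      using that hn mult_left_mono[of "real m" "real n" h] h0 by simp
    have split: "integral {0..h * real m} f = (\<Sum>x<m. integral {h * real x..h * real (Suc x)} f)" if "m \<le> n" for m
      using that
    proof (induction m)
      case (Suc m)
      have "f integrable_on {0..h * real (Suc m)}"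
        using le[OF Suc.prems] by (intro integrable_continuous_real continuous_on_subset[OF f]) auto
      then have "integral {0..h * real m} f + integral {h * real m..h * real (Suc m)} f = integral {0..h * real (Suc m)} f"
        using h0 by (intro Henstock_Kurzweil_Integration.integral_combine) auto
      then show ?case using Suc by simp
    qed simp
    have piece: "\<bar>h * f (h * real x) - integral {h * real x..h * real (Suc x)} f\<bar> \<le> e / (2 * c) * h" if "x < n" for x
    proof -
      have sub: "{h * real x..h * real (Suc x)} \<subseteq> {0..c}" using le[of "Suc x"] that h0 by auto
      have int: "f integrable_on {h * real x..h * real (Suc x)}"
        by (intro integrable_continuous_real continuous_on_subset[OF f sub])
      have const: "integral {h * real x..h * real (Suc x)} (\<lambda>_. f (h * real x)) = h * f (h * real x)"
        using h0 by (simp add: algebra_simps)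
      have "\<bar>integral {h * real x..h * real (Suc x)} (\<lambda>y. f y - f (h * real x))\<bar> \<le> e / (2 * c) * (h * real (Suc x) - h * real x)"
      proof (rule integral_bound[where f = "\<lambda>y. f y - f (h * real x)", unfolded real_norm_def])
        show "h * real x \<le> h * real (Suc x)" using h0 by simp
        show "continuous_on {h * real x..h * real (Suc x)} (\<lambda>y. f y - f (h * real x))"
          by (intro continuous_intros continuous_on_subset[OF f sub])
        fix y assume y: "y \<in> {h * real x..h * real (Suc x)}"
        have "h * real x \<in> {h * real x..h * real (Suc x)}" using h0 by simp
        then show "\<bar>f y - f (h * real x)\<bar> \<le> e / (2 * c)"
          using uc[of "h * real x" y] sub y hd by (auto simp: dist_real_def algebra_simps subset_iff)
      qed
      moreover have "integral {h * real x..h * real (Suc x)} (\<lambda>y. f y - f (h * real x))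
          = integral {h * real x..h * real (Suc x)} f - h * f (h * real x)"
        using int const by (subst integral_diff) auto
      ultimately show ?thesis by (simp add: algebra_simps abs_minus_commute)
    qed
    have "c / real n * (\<Sum>x<n. f (c * real x / real n)) - integral {0..c} f
        = (\<Sum>x<n. h * f (h * real x) - integral {h * real x..h * real (Suc x)} f)"
      using split[of n] hn by (simp add: h_def sum_subtractf sum_distrib_left)
    also have "\<bar>\<dots>\<bar> \<le> (\<Sum>x<n. e / (2 * c) * h)"
      by (intro order_trans[OF sum_abs sum_mono] piece) simp
    also have "\<dots> = e / 2" using hn c by (simp add: field_simps)
    finally show ?thesis using e by simp
  qed
  then show "\<exists>no. \<forall>n\<ge>no. norm (c / real n * (\<Sum>x<n. f (c * real x / real n)) - integral {0..c} f) < e"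
    by (intro exI[of _ "Suc N"]) auto
qed

section \<open>Cosine coefficients of the derivative weight\<close>

definition cos_coeff :: "real \<Rightarrow> nat \<Rightarrow> real" where
  "cos_coeff p j = integral {0..2 * pi} (\<lambda>t. sgn (cos t) * \<bar>cos t\<bar> powr (p - 1) * cos (real j * t))"

lemma continuous_on_cos_coeff:
  assumes "1 < p"
  shows "continuous_on A (\<lambda>t. sgn (cos t) * \<bar>cos t\<bar> powr (p - 1) * cos (real j * t))"
  using assms by (intro continuous_on_mult continuous_on_sgn_abs_powr continuous_intros) auto

text \<open>The derivative of \<open>\<bar>cos t\<bar>\<^sup>p sin ((j + 1) t)\<close> integrates to \<open>0\<close> over a period.\<close>

lemma cos_coeff_recurrence:
  assumes p: "1 < p"
  shows "(real j + 1 - p) * cos_coeff p j + (real j + 1 + p) * cos_coeff p (j + 2) = 0"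
proof -
  define \<psi> where "\<psi> t = sgn (cos t) * \<bar>cos t\<bar> powr (p - 1)" for t :: real
  have "((\<lambda>t. ((real j + 1 - p) * (\<psi> t * cos (real j * t)) + (real j + 1 + p) * (\<psi> t * cos (real (j + 2) * t))) / 2) has_integral
      (\<bar>cos (2 * pi)\<bar> powr p * sin ((real j + 1) * (2 * pi)) - \<bar>cos 0\<bar> powr p * sin ((real j + 1) * 0))) {0..2 * pi}"
  proof (rule fundamental_theorem_of_calculus)
    fix t :: real
    have "((\<lambda>t. \<bar>cos t\<bar> powr p * sin ((real j + 1) * t)) has_real_derivative
        (p * \<psi> t * (- sin t)) * sin ((real j + 1) * t) + (cos ((real j + 1) * t) * (real j + 1)) * \<bar>cos t\<bar> powr p) (at t)"
      unfolding \<psi>_def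
      by (intro DERIV_mult DERIV_chain2[OF DERIV_abs_powr[OF p]] DERIV_cos) (auto intro!: derivative_eq_intros)
    moreover have "\<bar>cos t\<bar> powr p = \<psi> t * cos t"
      by (auto simp: \<psi>_def powr_diff sgn_real_def divide_simps)
    moreover have "sin t * sin ((real j + 1) * t) = (cos (real j * t) - cos (real (j + 2) * t)) / 2"
      "cos t * cos ((real j + 1) * t) = (cos (real j * t) + cos (real (j + 2) * t)) / 2"
    proof -
      have a: "real j * t = (real j + 1) * t - t" "real (j + 2) * t = (real j + 1) * t + t"
        by (simp_all add: algebra_simps)
      show "sin t * sin ((real j + 1) * t) = (cos (real j * t) - cos (real (j + 2) * t)) / 2"
        "cos t * cos ((real j + 1) * t) = (cos (real j * t) + cos (real (j + 2) * t)) / 2"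
        unfolding a cos_add cos_diff by simp_all
    qed
    moreover have "p * \<psi> t * (- sin t) * sin ((real j + 1) * t) + cos ((real j + 1) * t) * (real j + 1) * (\<psi> t * cos t)
      = \<psi> t * ((real j + 1) * (cos t * cos ((real j + 1) * t)) - p * (sin t * sin ((real j + 1) * t)))"
      by (simp add: algebra_simps)
    ultimately have "((\<lambda>t. \<bar>cos t\<bar> powr p * sin ((real j + 1) * t)) has_real_derivative
       \<psi> t * ((real j + 1) * ((cos (real j * t) + cos (real (j + 2) * t)) / 2) - p * ((cos (real j * t) - cos (real (j + 2) * t)) / 2))) (at t)"
      by (simp only:)
    also have "\<psi> t * ((real j + 1) * ((cos (real j * t) + cos (real (j + 2) * t)) / 2) - p * ((cos (real j * t) - cos (real (j + 2) * t)) / 2))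
      = ((real j + 1 - p) * (\<psi> t * cos (real j * t)) + (real j + 1 + p) * (\<psi> t * cos (real (j + 2) * t))) / 2"
      by (simp add: field_simps)
    finally have "((\<lambda>t. \<bar>cos t\<bar> powr p * sin ((real j + 1) * t)) has_real_derivative
       ((real j + 1 - p) * (\<psi> t * cos (real j * t)) + (real j + 1 + p) * (\<psi> t * cos (real (j + 2) * t))) / 2) (at t)" .
    then show "((\<lambda>t. \<bar>cos t\<bar> powr p * sin ((real j + 1) * t)) has_vector_derivative
       ((real j + 1 - p) * (\<psi> t * cos (real j * t)) + (real j + 1 + p) * (\<psi> t * cos (real (j + 2) * t))) / 2) (at t within {0..2 * pi})"
      by (simp add: has_real_derivative_iff_has_vector_derivative has_vector_derivative_at_within)
  qed simp
  moreover have "sin ((real j + 1) * (2 * pi)) = 0"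
    using sin_npi[of "2 * (j + 1)"] by (simp add: algebra_simps)
  moreover have "((\<lambda>t. ((real j + 1 - p) * (\<psi> t * cos (real j * t)) + (real j + 1 + p) * (\<psi> t * cos (real (j + 2) * t))) / 2) has_integral
      ((real j + 1 - p) * cos_coeff p j + (real j + 1 + p) * cos_coeff p (j + 2)) / 2) {0..2 * pi}"
  proof -
    have "((\<lambda>t. \<psi> t * cos (real j * t)) has_integral cos_coeff p j) {0..2 * pi}" for j
      unfolding cos_coeff_def \<psi>_def
      by (intro integrable_integral integrable_continuous_real continuous_on_cos_coeff p)
    then show ?thesis by (intro has_integral_divide has_integral_add has_integral_mult_right)
  qed
  ultimately have "((real j + 1 - p) * cos_coeff p j + (real j + 1 + p) * cos_coeff p (j + 2)) / 2
      = \<bar>cos (2 * pi)\<bar> powr p * sin ((real j + 1) * (2 * pi)) - \<bar>cos 0\<bar> powr p * sin ((real j + 1) * 0)"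
    using has_integral_unique by blast
  also have "\<dots> = 0" using \<open>sin ((real j + 1) * (2 * pi)) = 0\<close> by simp
  finally show ?thesis by simp
qed

text \<open>For j = 1 the integrand is |cos t|^p, which is continuous, nonnegative and nonzero at
  0.\<close>

lemma cos_coeff_1_pos:
  assumes p: "1 < p"
  shows "0 < cos_coeff p 1"
proof -
  let ?f = "\<lambda>t. sgn (cos t) * \<bar>cos t\<bar> powr (p - 1) * cos (real 1 * t)"
  have int: "(?f has_integral cos_coeff p 1) (cbox 0 (2 * pi))"
    unfolding cos_coeff_def cbox_interval
    by (intro integrable_integral integrable_continuous_real continuous_on_cos_coeff p)
  have nn: "0 \<le> ?f t" for t by (simp add: sgn_real_def zero_le_mult_iff mult_le_0_iff)
  have "0 \<le> cos_coeff p 1" using int nn by (rule has_integral_nonneg)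
  moreover have "cos_coeff p 1 \<noteq> 0"
  proof
    assume "cos_coeff p 1 = 0"
    then have "(?f has_integral 0) (cbox 0 (2 * pi))" using int by simp
    moreover have "box 0 (2 * pi) \<noteq> {}" "0 \<in> cbox 0 (2 * pi)"
      using pi_gt_zero unfolding box_real by (simp_all add: not_le del: pi_gt_zero)
    ultimately have "?f 0 = 0"
      using has_integral_0_cbox_imp_0[of 0 "2 * pi" ?f 0] continuous_on_cos_coeff[OF p, of _ 1] nn by blast
    then show False by simp
  qed
  ultimately show ?thesis by simp
qed

text \<open>Along odd j the recursion multiplies the coefficient by a number with the sign of p - (j
  + 1). From a positive value at j = 1 the sign stays positive while j + 1 < p and turns negative at
  the first step beyond; an even p would instead hit 0 there.\<close>

lemma ex_cos_coeff_neg: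
  assumes p: "1 < p" and not_even: "\<nexists>m::int. even m \<and> p = of_int m"
  shows "\<exists>j. 3 \<le> j \<and> cos_coeff p j < 0"
proof -
  have rec: "(real j + 1 + p) * cos_coeff p (j + 2) = (p - (real j + 1)) * cos_coeff p j" for j
    using cos_coeff_recurrence[OF p, of j] by (simp add: algebra_simps)
  have pos: "0 < cos_coeff p (2 * i + 1)" if "2 * real i < p" for i
    using that
  proof (induction i)
    case 0
    then show ?case using cos_coeff_1_pos[OF p] by simp
  next
    case (Suc i)
    have "(real (2 * i + 1) + 1 + p) * cos_coeff p (2 * i + 1 + 2) = (p - (real (2 * i + 1) + 1)) * cos_coeff p (2 * i + 1)"
      by (rule rec)
    also have "\<dots> > 0" using Suc by (intro mult_pos_pos) auto
    finally show ?case using p by (simp add: zero_less_mult_iff)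
  qed
  \<comment> \<open>The largest \<open>i\<close> with 2 i < p. Then 2 (i + 1) is the first even
    number that is at least p, and it exceeds p as p is not even.\<close>
  define i where "i = nat \<lceil>p / 2\<rceil> - 1"
  have ceil: "1 \<le> \<lceil>p / 2\<rceil>" using p by linarith
  have "int i = \<lceil>p / 2\<rceil> - 1" using ceil unfolding i_def by linarith
  then have i: "real i = of_int \<lceil>p / 2\<rceil> - 1" by linarith
  have "2 * real i < p" using i ceiling_correct[of "p / 2"] by linarith
  note J = pos[OF this]
  have "p / 2 \<le> real i + 1" unfolding i using le_of_int_ceiling[of "p / 2"] by simp
  then have "p \<le> 2 * (real i + 1)" by simp
  moreover have "p \<noteq> 2 * (real i + 1)"
  proof
    assume "p = 2 * (real i + 1)"
    then have "even (2 * (int i + 1)) \<and> p = of_int (2 * (int i + 1))" by simp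
    then show False using not_even by blast
  qed
  ultimately have lt: "p < 2 * (real i + 1)" by simp
  have "(real (2 * i + 1) + 1 + p) * cos_coeff p (2 * i + 1 + 2) = (p - (real (2 * i + 1) + 1)) * cos_coeff p (2 * i + 1)"
    by (rule rec)
  also have "\<dots> < 0" using J lt by (intro mult_neg_pos) auto
  finally have "cos_coeff p (2 * i + 1 + 2) < 0" using p by (simp add: mult_less_0_iff)
  then show ?thesis by (intro exI[of _ "2 * i + 1 + 2"]) simp
qed

section \<open>From the integral to sums over \<int>/n\<close>

lemma ex_discrete_cos_coeff_neg:
  assumes "1 < p" "cos_coeff p j < 0"
  shows "\<exists>n>m. (\<Sum>x<n. sgn (cos (2 * pi * real x / real n)) * \<bar>cos (2 * pi * real x / real n)\<bar> powr (p - 1)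
      * cos (real j * (2 * pi * real x / real n))) < 0"
proof -
  let ?f = "\<lambda>t. sgn (cos t) * \<bar>cos t\<bar> powr (p - 1) * cos (real j * t)"
  have "(\<lambda>n. 2 * pi / real n * (\<Sum>x<n. ?f (2 * pi * real x / real n))) \<longlonglongrightarrow> cos_coeff p j"
    unfolding cos_coeff_def by (intro riemann_sums_tendsto continuous_on_cos_coeff assms) simp
  from order_tendstoD(2)[OF this assms(2)]
  have "\<forall>\<^sub>F n in sequentially. 2 * pi / real n * (\<Sum>x<n. ?f (2 * pi * real x / real n)) < 0" .
  \<comment> \<open>The lower bound lets n exceed 2 j later, which keeps the frequencies 0,
    \<plusminus> 1 and \<plusminus> j distinct modulo n.\<close>
  then have "\<forall>\<^sub>F n in sequentially. m < n \<and> 2 * pi / real n * (\<Sum>x<n. ?f (2 * pi * real x / real n)) < 0"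
    using eventually_gt_at_top[of m] by eventually_elim simp
  then obtain n where n: "m < n" "2 * pi / real n * (\<Sum>x<n. ?f (2 * pi * real x / real n)) < 0"
    using eventually_happens' sequentially_bot by blast
  then have "(\<Sum>x<n. ?f (2 * pi * real x / real n)) < 0"
    by (subst (asm) mult_less_0_iff) (auto simp: divide_less_0_iff)
  with n show ?thesis by blast
qed

text \<open>Under the reflection of x to n - x the cosine is unchanged and the sine changes sign, so
  the terms cancel; x = 0 contributes sin 0 = 0. Applied to the derivative weight, this means that
  the sine perturbation on the reflections has no first-order effect.\<close>

lemma sum_sin_odd_weight:
  fixes w :: "real \<Rightarrow> real"
  shows "(\<Sum>x<n. w (cos (2 * pi * real x / real n)) * sin (real j * (2 * pi * real x / real n))) = 0"
proof -
  let ?g = "\<lambda>x. w (cos (2 * pi * real x / real n)) * sin (real j * (2 * pi * real x / real n))"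
  have refl: "?g (n - x) = - ?g x" if "x \<in> {1..<n}" for x
  proof -
    have "2 * pi * real (n - x) / real n = 2 * pi - 2 * pi * real x / real n"
      using that by (simp add: of_nat_diff field_simps)
    moreover have "cos (2 * pi - y) = cos y" for y :: real by (simp add: cos_diff)
    moreover have "sin (real j * (2 * pi - y)) = - sin (real j * y)" for y
      using sin_npi[of "2 * j"] cos_npi[of "2 * j"] by (simp add: right_diff_distrib sin_diff mult_ac)
    ultimately show ?thesis by simp
  qed
  have "(\<Sum>x\<in>{1..<n}. ?g x) = (\<Sum>x\<in>{1..<n}. - ?g x)"
    by (rule sum.reindex_bij_witness[of _ "\<lambda>x. n - x" "\<lambda>x. n - x"]) (use refl in auto)
  then have "(\<Sum>x\<in>{1..<n}. ?g x) = 0" by (simp add: sum_negf)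
  moreover have "(\<Sum>x<n. ?g x) = (\<Sum>x\<in>{1..<n}. ?g x)"
    by (rule sum.mono_neutral_right) (auto simp: not_less_eq_eq)
  ultimately show ?thesis by simp
qed

text \<open>The derivative in \<eta> at 0 is p times the cosine sum, a sampled
  \<open>cos_coeff\<close>, plus p times the sine sum, which vanishes. It is negative, so small
  positive \<eta> lower the sum.\<close>

lemma ex_norm_decreasing_perturbation:
  assumes p: "1 < p"
    and neg: "(\<Sum>x<n. sgn (cos (2 * pi * real x / real n)) * \<bar>cos (2 * pi * real x / real n)\<bar> powr (p - 1)
      * cos (real j * (2 * pi * real x / real n))) < 0"
  shows "\<exists>\<eta>>0. \<eta> < 1 \<and>
    (\<Sum>x<n. \<bar>cos (2 * pi * real x / real n) + \<eta> * cos (real j * (2 * pi * real x / real n))\<bar> powr p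
        + \<bar>cos (2 * pi * real x / real n) + \<eta> * sin (real j * (2 * pi * real x / real n))\<bar> powr p)
    < (\<Sum>x<n. \<bar>cos (2 * pi * real x / real n)\<bar> powr p + \<bar>cos (2 * pi * real x / real n)\<bar> powr p)"
proof -
  define t where "t x = 2 * pi * real x / real n" for x :: nat
  define \<psi> where "\<psi> y = sgn y * \<bar>y\<bar> powr (p - 1)" for y :: real
  define \<Phi> where "\<Phi> \<eta> = (\<Sum>x<n. \<bar>cos (t x) + \<eta> * cos (real j * t x)\<bar> powr p + \<bar>cos (t x) + \<eta> * sin (real j * t x)\<bar> powr p)" for \<eta>
  have d: "((\<lambda>\<eta>. \<bar>a + \<eta> * b\<bar> powr p) has_real_derivative p * \<psi> a * b) (at 0)" for a b
  proof -
    have "((\<lambda>\<eta>. \<bar>a + \<eta> * b\<bar> powr p) has_real_derivative p * (sgn (a + 0 * b) * \<bar>a + 0 * b\<bar> powr (p - 1)) * b) (at 0)"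
      by (rule DERIV_chain2[OF DERIV_abs_powr[OF p]]) (auto intro!: derivative_eq_intros)
    then show ?thesis by (simp add: \<psi>_def)
  qed
  have "(\<Phi> has_real_derivative (\<Sum>x<n. p * \<psi> (cos (t x)) * cos (real j * t x) + p * \<psi> (cos (t x)) * sin (real j * t x))) (at 0)"
    unfolding \<Phi>_def by (intro DERIV_sum DERIV_add d)
  also have "(\<Sum>x<n. p * \<psi> (cos (t x)) * cos (real j * t x) + p * \<psi> (cos (t x)) * sin (real j * t x))
      = p * (\<Sum>x<n. \<psi> (cos (t x)) * cos (real j * t x)) + p * (\<Sum>x<n. \<psi> (cos (t x)) * sin (real j * t x))"
    by (simp add: sum.distrib sum_distrib_left mult.assoc)
  also have "(\<Sum>x<n. \<psi> (cos (t x)) * sin (real j * t x)) = 0"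
    unfolding t_def by (rule sum_sin_odd_weight)
  finally have D: "(\<Phi> has_real_derivative p * (\<Sum>x<n. \<psi> (cos (t x)) * cos (real j * t x))) (at 0)" by simp
  have "p * (\<Sum>x<n. \<psi> (cos (t x)) * cos (real j * t x)) < 0"
    using neg p by (simp add: mult_less_0_iff t_def \<psi>_def)
  from DERIV_neg_dec_right[OF D this] obtain d where d: "0 < d" "\<And>h. 0 < h \<Longrightarrow> h < d \<Longrightarrow> \<Phi> (0 + h) < \<Phi> 0" by blast
  \<comment> \<open>Halving keeps \<eta> inside the range of the derivative estimate and below 1, so
    that -ln \<eta> is positive later.\<close>
  define \<eta> where "\<eta> = min d 1 / 2"
  have "0 < \<eta>" "\<eta> < d" "\<eta> < 1" using d by (auto simp: \<eta>_def)
  with d(2)[of \<eta>] show ?thesis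
    by (intro exI[of _ \<eta>]) (simp add: \<Phi>_def t_def)
qed

section \<open>Asymptotics of the walk\<close>

lemma rate_transform_0: "rate_transform n l 0 = of_real (sum l {0..<int n})"
  by (simp add: rate_transform_def chi_def)

text \<open>With B the total rate, frequency 0 contributes exp (-B) cosh B / n or exp (-B) sinh B /
  n, which differs from 1 / (2 n) only by \<plusminus> exp (-2 B) / (2 n). Scaling by n exp (B - q)
  removes the common prefactor and weighs every other frequency by exp (-q), where \<open>q\<close>
  is to be the dominant modulus.\<close>

lemma scaled_walk_prob:
  fixes q :: real
  assumes n: "0 < n" and l: "\<And>x. x \<in> {0..<int n} \<Longrightarrow> 0 < l x" and x: "x \<in> {0..<int n}"
  shows "complex_of_real (real n * exp (sum l {0..<int n} - q) *
        (walk_prob (dihedral n) (reflection_rates l) 1 (x, False) - 1 / (2 * real n)))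
      = of_real (exp (- sum l {0..<int n} - q) / 2)
        + (\<Sum>k\<in>{1..<int n}. chi n k (- x) * of_real (exp (- q) * cosh (norm (rate_transform n l k))))" (is ?A)
    and "complex_of_real (real n * exp (sum l {0..<int n} - q) *
        (walk_prob (dihedral n) (reflection_rates l) 1 (x, True) - 1 / (2 * real n)))
      = - of_real (exp (- sum l {0..<int n} - q) / 2)
        + (\<Sum>k\<in>{1..<int n}. chi n k (- x) *
            (of_real (exp (- q) * sinh (norm (rate_transform n l k))) * sgn (rate_transform n l k)))" (is ?B)
proof -
  define B where "B = sum l {0..<int n}"
  define M where "M = real n * exp (B - q)"
  have B: "0 < B" unfolding B_def using n l by (intro sum_pos) auto
  have M: "M * (exp (- B) / n) = exp (- q)"
    using n by (simp add: M_def exp_add[symmetric])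
  have M': "M * (1 / (2 * real n)) = exp (- q) * (exp B / 2)"
    using n by (simp add: M_def exp_add[symmetric])
  have split: "sum f {0..<int n} = f 0 + sum f {1..<int n}" for f :: "int \<Rightarrow> complex"
  proof -
    have "{0..<int n} = insert 0 {1..<int n}" using n by auto
    then show ?thesis by simp
  qed
  have e: "exp (- B - q) / 2 = exp (- q) * (cosh B - exp B / 2)" "- (exp (- B - q) / 2) = exp (- q) * (sinh B - exp B / 2)"
    by (simp_all add: cosh_def sinh_def exp_diff exp_minus field_simps)
  have chi0: "chi n 0 (- x) = 1" by (simp add: chi_def)
  have sgnB: "sgn (complex_of_real B) = 1" "norm (complex_of_real B) = B" using B by (simp_all add: sgn_of_real)
  note P1 = dihedral_walk_prob(1)[where l = l, OF n l x, folded B_def]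
  note P2 = dihedral_walk_prob(2)[where l = l, OF n l x, folded B_def]
  have "complex_of_real (M * (walk_prob (dihedral n) (reflection_rates l) 1 (x, False) - 1 / (2 * real n)))
      = of_real (M * (exp (- B) / n)) * (\<Sum>k\<in>{0..<int n}. chi n k (- x) * of_real (cosh (norm (rate_transform n l k))))
        - of_real (M * (1 / (2 * real n)))"
    by (simp only: right_diff_distrib of_real_diff of_real_mult P1 mult.assoc)
  also have "\<dots> = of_real (exp (- q) * (cosh B - exp B / 2))
      + (\<Sum>k\<in>{1..<int n}. chi n k (- x) * of_real (exp (- q) * cosh (norm (rate_transform n l k))))"
    unfolding M M' split rate_transform_0 chi0 B_def[symmetric] sgnB
    by (simp add: algebra_simps sum_distrib_left)
  finally show ?A unfolding e(1)[symmetric] by (simp only: M_def B_def)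
  have "complex_of_real (M * (walk_prob (dihedral n) (reflection_rates l) 1 (x, True) - 1 / (2 * real n)))
      = of_real (M * (exp (- B) / n)) * (\<Sum>k\<in>{0..<int n}. chi n k (- x) *
          (of_real (sinh (norm (rate_transform n l k))) * sgn (rate_transform n l k)))
        - of_real (M * (1 / (2 * real n)))"
    by (simp only: right_diff_distrib of_real_diff of_real_mult P2 mult.assoc)
  also have "\<dots> = of_real (exp (- q) * (sinh B - exp B / 2))
      + (\<Sum>k\<in>{1..<int n}. chi n k (- x) *
          (of_real (exp (- q) * sinh (norm (rate_transform n l k))) * sgn (rate_transform n l k)))"
    unfolding M M' split rate_transform_0 chi0 B_def[symmetric] sgnB
    by (simp add: algebra_simps sum_distrib_left)
  finally show ?B unfolding e(2)[symmetric] of_real_minus[symmetric] by (simp only: M_def B_def)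
qed

text \<open>Passes to the limit frequency by frequency, so \<open>u\<close> and \<open>v\<close> are
  the limiting profiles on rotations and reflections. The factor pulled out of the p-th powers does
  not depend on the group element.\<close>

lemma scaled_lp_sum_tendsto:
  fixes q :: "real \<Rightarrow> real" and l :: "real \<Rightarrow> int \<Rightarrow> real" and u v :: "int \<Rightarrow> real"
  assumes n: "0 < n" and p: "0 < p"
    and l: "\<forall>\<^sub>F s in at_top. \<forall>x\<in>{0..<int n}. 0 < l s x"
    and e: "((\<lambda>s. exp (- sum (l s) {0..<int n} - q s)) \<longlongrightarrow> 0) at_top"
    and a: "\<And>k. k \<in> {1..<int n} \<Longrightarrow>
      ((\<lambda>s. complex_of_real (exp (- q s) * cosh (norm (rate_transform n (l s) k)))) \<longlongrightarrow> a k) at_top"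
    and c: "\<And>k. k \<in> {1..<int n} \<Longrightarrow>
      ((\<lambda>s. of_real (exp (- q s) * sinh (norm (rate_transform n (l s) k))) * sgn (rate_transform n (l s) k)) \<longlongrightarrow> c k) at_top"
    and u: "\<And>x. x \<in> {0..<int n} \<Longrightarrow> (\<Sum>k\<in>{1..<int n}. chi n k (- x) * a k) = of_real (u x)"
    and v: "\<And>x. x \<in> {0..<int n} \<Longrightarrow> (\<Sum>k\<in>{1..<int n}. chi n k (- x) * c k) = of_real (v x)"
  shows "((\<lambda>s. (real n * exp (sum (l s) {0..<int n} - q s)) powr p *
      (\<Sum>g\<in>carrier (dihedral n). \<bar>walk_prob (dihedral n) (reflection_rates (l s)) 1 g - 1 / real (order (dihedral n))\<bar> powr p))
    \<longlongrightarrow> (\<Sum>x\<in>{0..<int n}. \<bar>u x\<bar> powr p + \<bar>v x\<bar> powr p)) at_top"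
proof -
  define M where "M s = real n * exp (sum (l s) {0..<int n} - q s)" for s
  define W where "W s g = walk_prob (dihedral n) (reflection_rates (l s)) 1 g - 1 / (2 * real n)" for s g
  have Mpos: "0 < M s" for s using n by (simp add: M_def)
  have e2: "((\<lambda>s. complex_of_real (exp (- sum (l s) {0..<int n} - q s) / 2)) \<longlongrightarrow> 0) at_top"
  proof -
    have "((\<lambda>s. exp (- sum (l s) {0..<int n} - q s) / 2) \<longlongrightarrow> 0) at_top"
      using tendsto_divide[OF e tendsto_const[of 2]] by simp
    from tendsto_of_real[OF this, where 'a = complex] show ?thesis by (simp only: of_real_0)
  qed
  have tF: "((\<lambda>s. M s * W s (x, False)) \<longlongrightarrow> u x) at_top" if x: "x \<in> {0..<int n}" for x
  proof -
    have "((\<lambda>s. complex_of_real (exp (- sum (l s) {0..<int n} - q s) / 2)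
        + (\<Sum>k\<in>{1..<int n}. chi n k (- x) * of_real (exp (- q s) * cosh (norm (rate_transform n (l s) k)))))
      \<longlongrightarrow> 0 + of_real (u x)) at_top"
      unfolding u[OF x, symmetric] by (intro tendsto_add e2 tendsto_sum tendsto_mult tendsto_const a)
    moreover have "\<forall>\<^sub>F s in at_top. complex_of_real (exp (- sum (l s) {0..<int n} - q s) / 2)
        + (\<Sum>k\<in>{1..<int n}. chi n k (- x) * of_real (exp (- q s) * cosh (norm (rate_transform n (l s) k))))
        = complex_of_real (M s * W s (x, False))"
      using l
    proof eventually_elim
      case (elim s)
      show ?case unfolding M_def W_def by (rule scaled_walk_prob(1)[OF n _ x, symmetric]) (use elim in auto)
    qed
    ultimately have "((\<lambda>s. complex_of_real (M s * W s (x, False))) \<longlongrightarrow> of_real (u x)) at_top"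
      by (auto elim: Lim_transform_eventually)
    then show ?thesis by (simp only: tendsto_of_real_iff)
  qed
  have tT: "((\<lambda>s. M s * W s (x, True)) \<longlongrightarrow> v x) at_top" if x: "x \<in> {0..<int n}" for x
  proof -
    have "((\<lambda>s. - complex_of_real (exp (- sum (l s) {0..<int n} - q s) / 2)
        + (\<Sum>k\<in>{1..<int n}. chi n k (- x) *
          (of_real (exp (- q s) * sinh (norm (rate_transform n (l s) k))) * sgn (rate_transform n (l s) k))))
      \<longlongrightarrow> - 0 + of_real (v x)) at_top"
      unfolding v[OF x, symmetric] by (intro tendsto_add tendsto_minus e2 tendsto_sum tendsto_mult[OF tendsto_const] c)
    moreover have "\<forall>\<^sub>F s in at_top. - complex_of_real (exp (- sum (l s) {0..<int n} - q s) / 2)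
        + (\<Sum>k\<in>{1..<int n}. chi n k (- x) *
          (of_real (exp (- q s) * sinh (norm (rate_transform n (l s) k))) * sgn (rate_transform n (l s) k)))
        = complex_of_real (M s * W s (x, True))"
      using l
    proof eventually_elim
      case (elim s)
      show ?case unfolding M_def W_def by (rule scaled_walk_prob(2)[OF n _ x, symmetric]) (use elim in auto)
    qed
    ultimately have "((\<lambda>s. complex_of_real (M s * W s (x, True))) \<longlongrightarrow> of_real (v x)) at_top"
      by (auto elim: Lim_transform_eventually)
    then show ?thesis by (simp only: tendsto_of_real_iff)
  qed
  have pw: "((\<lambda>s. \<bar>f s\<bar> powr p) \<longlongrightarrow> \<bar>y\<bar> powr p) at_top" if "(f \<longlongrightarrow> y) at_top" for f :: "real \<Rightarrow> real" and y
    using that p by (intro tendsto_powr' tendsto_rabs tendsto_const) auto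
  have "((\<lambda>s. \<Sum>x\<in>{0..<int n}. \<bar>M s * W s (x, False)\<bar> powr p + \<bar>M s * W s (x, True)\<bar> powr p)
      \<longlongrightarrow> (\<Sum>x\<in>{0..<int n}. \<bar>u x\<bar> powr p + \<bar>v x\<bar> powr p)) at_top"
    by (intro tendsto_sum tendsto_add pw tF tT)
  moreover have "(\<Sum>x\<in>{0..<int n}. \<bar>M s * W s (x, False)\<bar> powr p + \<bar>M s * W s (x, True)\<bar> powr p)
      = M s powr p * (\<Sum>g\<in>carrier (dihedral n).
          \<bar>walk_prob (dihedral n) (reflection_rates (l s)) 1 g - 1 / real (order (dihedral n))\<bar> powr p)" for s
  proof -
    have "(\<Sum>g\<in>carrier (dihedral n). \<bar>W s g\<bar> powr p) = (\<Sum>x\<in>{0..<int n}. \<Sum>b\<in>UNIV. \<bar>W s (x, b)\<bar> powr p)"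
      by (simp add: dihedral_def sum.cartesian_product)
    also have "\<dots> = (\<Sum>x\<in>{0..<int n}. \<bar>W s (x, False)\<bar> powr p + \<bar>W s (x, True)\<bar> powr p)"
      by (simp add: UNIV_bool)
    finally show ?thesis
      using Mpos[of s] by (simp add: W_def order_dihedral abs_mult powr_mult sum_distrib_left distrib_left)
  qed
  ultimately show ?thesis by (simp only: M_def)
qed

section \<open>The two-mode rates and their transform\<close>

lemma sum_chi_freq:
  assumes "0 < n"
  shows "(\<Sum>x\<in>{0..<int n}. chi n m x) = (if int n dvd m then of_nat n else 0)"
  using chi_sum[OF assms, of m] by (simp only: chi_commute[of n _ m])

lemma chi_freq_add: "chi n (k + m) x = chi n k x * chi n m x"
  using chi_add[of n x k m] by (simp only: chi_commute[of n x])

lemma chi_freq_minus: "chi n (- k) x = cnj (chi n k x)"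
  using chi_minus[of n x k] by (simp only: chi_commute[of n x])

lemma Re_chi: "Re (chi n k x) = cos (2 * pi * of_int k * of_int x / real n)"
  and Im_chi: "Im (chi n k x) = sin (2 * pi * of_int k * of_int x / real n)"
  by (simp_all add: chi_def)

text \<open>Chosen so that, apart from the trivial frequency, the transform is \<open>s\<close> at \<open>\<plusminus> 1\<close>,
  \<open>\<plusminus> \<i> (s - \<kappa>)\<close> at \<open>\<plusminus> j\<close> and \<open>0\<close> elsewhere; the constant \<open>4 s\<close> only makes the rates positive.\<close>

definition two_mode_rates :: "nat \<Rightarrow> nat \<Rightarrow> real \<Rightarrow> real \<Rightarrow> int \<Rightarrow> real" where
  "two_mode_rates n j \<kappa> s x = (4 * s + 2 * s * cos (2 * pi * of_int x / real n)
     + 2 * (s - \<kappa>) * sin (2 * pi * real j * of_int x / real n)) / real n"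

text \<open>The worst case of the two trigonometric terms still leaves 4 s - 2 s - 2 (s - \<kappa>)
  = 2 \<kappa> in the numerator.\<close>

lemma two_mode_rates_pos:
  assumes "0 < n" "0 < \<kappa>" "\<kappa> < s"
  shows "0 < two_mode_rates n j \<kappa> s x"
proof -
  have "- 1 * (2 * s) \<le> cos (2 * pi * of_int x / real n) * (2 * s)"
    using assms by (intro mult_right_mono) auto
  moreover have "- 1 * (2 * (s - \<kappa>)) \<le> sin (2 * pi * real j * of_int x / real n) * (2 * (s - \<kappa>))"
    using assms by (intro mult_right_mono) auto
  ultimately show ?thesis using assms unfolding two_mode_rates_def by (intro divide_pos_pos) (auto simp: algebra_simps)
qed

text \<open>The cosine is carried by the frequencies \<plusminus> 1 and the sine by \<plusminus> j,
  with opposite imaginary coefficients. The conditions on \<open>j\<close> and \<open>n\<close> keep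
  0, 1, j, n - j and n - 1 distinct.\<close>

lemma rate_transform_two_mode:
  assumes j: "3 \<le> j" "2 * j < n" and k: "k \<in> {0..<int n}"
  shows "rate_transform n (two_mode_rates n j \<kappa> s) k =
     (if k = 0 then of_real (4 * s) else 0) + (if k = 1 \<or> k = int n - 1 then of_real s else 0)
     + (if k = int j then \<i> * of_real (s - \<kappa>) else 0) - (if k = int n - int j then \<i> * of_real (s - \<kappa>) else 0)"
proof -
  have n: "0 < n" using j by simp
  have two_mode: "complex_of_real (two_mode_rates n j \<kappa> s x) * chi n k x = (of_real (4 * s) * chi n k x
      + of_real s * (chi n (k + 1) x + chi n (k - 1) x) - \<i> * of_real (s - \<kappa>) * (chi n (k + int j) x - chi n (k - int j) x)) / of_nat n" for x
  proof -
    define a b where "a = 2 * cos (2 * pi * of_int x / real n)" and "b = 2 * sin (2 * pi * real j * of_int x / real n)"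
    have "complex_of_real a = chi n 1 x + cnj (chi n 1 x)"
      by (simp add: a_def complex_eq_iff Re_chi)
    moreover have "complex_of_real b = - \<i> * (chi n (int j) x - cnj (chi n (int j) x))"
      by (simp add: b_def complex_eq_iff Im_chi)
    moreover have "two_mode_rates n j \<kappa> s x = (4 * s + s * a + (s - \<kappa>) * b) / real n"
      by (simp add: two_mode_rates_def a_def b_def)
    ultimately have "complex_of_real (two_mode_rates n j \<kappa> s x) = (of_real (4 * s) + of_real s * (chi n 1 x + cnj (chi n 1 x))
        + of_real (s - \<kappa>) * (- \<i> * (chi n (int j) x - cnj (chi n (int j) x)))) / of_nat n"
      by (simp only: of_real_add of_real_mult of_real_divide of_real_of_nat_eq)
    moreover have "chi n (k - m) x = chi n k x * cnj (chi n m x)" for m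
      using chi_freq_add[of n k "- m" x] by (simp add: chi_freq_minus)
    ultimately show ?thesis by (simp add: chi_freq_add algebra_simps)
  qed
  have dvd: "int n dvd k \<longleftrightarrow> k = 0" "int n dvd k + 1 \<longleftrightarrow> k = int n - 1" "int n dvd k - 1 \<longleftrightarrow> k = 1"
    "int n dvd k + int j \<longleftrightarrow> k = int n - int j" "int n dvd k - int j \<longleftrightarrow> k = int j"
  proof -
    \<comment> \<open>All shifted frequencies lie strictly between -n and 2 n, where the only
      multiples of n are 0 and n.\<close>
    have D: "int n dvd y \<longleftrightarrow> y = 0 \<or> y = int n" if "- int n < y" "y < 2 * int n" for y
    proof
      assume "int n dvd y"
      then obtain m where m: "y = int n * m" by (elim dvdE)
      have "- 1 < m" using that(1) n m mult_less_cancel_left_pos[of "int n" "- 1" m] by simp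
      moreover have "m < 2" using that(2) n m mult_less_cancel_left_pos[of "int n" m 2] by (simp add: mult.commute)
      ultimately have "m = 0 \<or> m = 1" by linarith
      then show "y = 0 \<or> y = int n" using m by auto
    qed auto
    show "int n dvd k \<longleftrightarrow> k = 0" "int n dvd k + 1 \<longleftrightarrow> k = int n - 1" "int n dvd k - 1 \<longleftrightarrow> k = 1"
      "int n dvd k + int j \<longleftrightarrow> k = int n - int j" "int n dvd k - int j \<longleftrightarrow> k = int j"
      using k j by (subst D; auto)+
  qed
  have "rate_transform n (two_mode_rates n j \<kappa> s) k = (of_real (4 * s) * (\<Sum>x\<in>{0..<int n}. chi n k x)
      + of_real s * ((\<Sum>x\<in>{0..<int n}. chi n (k + 1) x) + (\<Sum>x\<in>{0..<int n}. chi n (k - 1) x))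
      - \<i> * of_real (s - \<kappa>) * ((\<Sum>x\<in>{0..<int n}. chi n (k + int j) x) - (\<Sum>x\<in>{0..<int n}. chi n (k - int j) x))) / of_nat n"
    unfolding rate_transform_def two_mode
    by (simp only: sum_divide_distrib[symmetric] sum_subtractf sum.distrib sum_distrib_left[symmetric])
  then show ?thesis
    unfolding sum_chi_freq[OF n] dvd using n j k by (auto simp: add_divide_distrib diff_divide_distrib right_diff_distrib)
qed

lemma tendsto_exp_cosh_sinh:
  fixes \<kappa> :: real
  shows "((\<lambda>s. exp (- s) * cosh (s - \<kappa>)) \<longlongrightarrow> exp (- \<kappa>) / 2) at_top"
    and "((\<lambda>s. exp (- s) * sinh (s - \<kappa>)) \<longlongrightarrow> exp (- \<kappa>) / 2) at_top"
proof -
  have eq: "exp (- s) * cosh (s - \<kappa>) = exp (- \<kappa>) / 2 + exp (\<kappa> - 2 * s) / 2"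
    "exp (- s) * sinh (s - \<kappa>) = exp (- \<kappa>) / 2 - exp (\<kappa> - 2 * s) / 2" for s
    by (simp_all add: cosh_def sinh_def field_simps exp_add[symmetric])
  show "((\<lambda>s. exp (- s) * cosh (s - \<kappa>)) \<longlongrightarrow> exp (- \<kappa>) / 2) at_top"
    "((\<lambda>s. exp (- s) * sinh (s - \<kappa>)) \<longlongrightarrow> exp (- \<kappa>) / 2) at_top"
    unfolding eq by real_asymp+
qed

lemma chi_freq_reflect: "chi n (int n - m) (- x) = chi n m x"
proof -
  have "chi n (int n) (- x) = 1" using chi_mult_eq_1[of n "- x" 1] by (simp add: chi_commute)
  then have "chi n (int n + - m) (- x) = chi n (- m) (- x)" by (simp only: chi_freq_add mult_1_left)
  then show ?thesis by (simp add: chi_freq_minus chi_minus)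
qed

text \<open>Inverse transform of a limit supported on \<plusminus> 1 and \<plusminus> j. The
  coefficients at j and n - j are kept separate: equal real ones produce a cosine, opposite
  imaginary ones a sine.\<close>

lemma sum_chi_four_modes:
  assumes j: "3 \<le> j" "2 * j < n"
  shows "(\<Sum>k\<in>{1..<int n}. chi n k (- x) * ((if k = 1 \<or> k = int n - 1 then a else 0)
      + (if k = int j then c else 0) + (if k = int n - int j then d else 0)))
    = a * (cnj (chi n 1 x) + chi n 1 x) + c * cnj (chi n (int j) x) + d * chi n (int j) x"
proof -
  have or: "(if k = 1 \<or> k = int n - 1 then a else 0) = (if k = 1 then a else 0) + (if k = int n - 1 then a else 0)" for k
    using j by auto
  have pull: "y * (if P then b else 0) = (if P then y * b else 0)" for y b :: complex and P by simp
  have "(\<Sum>k\<in>{1..<int n}. chi n k (- x) * ((if k = 1 \<or> k = int n - 1 then a else 0)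
      + (if k = int j then c else 0) + (if k = int n - int j then d else 0)))
    = chi n 1 (- x) * a + chi n (int n - 1) (- x) * a + chi n (int j) (- x) * c + chi n (int n - int j) (- x) * d"
    unfolding or distrib_left sum.distrib pull using j by simp
  also have "\<dots> = a * (cnj (chi n 1 x) + chi n 1 x) + c * cnj (chi n (int j) x) + d * chi n (int j) x"
    unfolding chi_freq_reflect unfolding chi_minus by (simp add: algebra_simps)
  finally show ?thesis .
qed

text \<open>The extra rate is a point mass at x = 0, that is at the reflection b, and its transform
  is constant in the frequency.\<close>

lemma rate_transform_add_identity:
  assumes "0 < n"
  shows "rate_transform n (\<lambda>x. l x + (if x = 0 then c else 0)) k = rate_transform n l k + of_real c"
proof -
  have "of_real (l x + (if x = 0 then c else 0)) * chi n k x = of_real (l x) * chi n k x + (if x = 0 then of_real c else 0)" for x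
    by (auto simp: distrib_right)
  then show ?thesis using assms by (simp add: rate_transform_def sum.distrib)
qed

lemma sum_two_mode:
  assumes j: "3 \<le> j" "2 * j < n"
  shows "sum (two_mode_rates n j \<kappa> s) {0..<int n} = 4 * s"
proof -
  have "complex_of_real (sum (two_mode_rates n j \<kappa> s) {0..<int n}) = of_real (4 * s)"
    unfolding rate_transform_0[symmetric] using j by (subst rate_transform_two_mode) auto
  then show ?thesis by (simp only: of_real_eq_iff)
qed

text \<open>On nonnegative arguments cosh and sinh are at most exp, and the exponent -2 s + 3 s / 2
  = -s / 2 tends to minus infinity; \<open>sgn\<close> has modulus at most 1.\<close>

lemma tendsto_subdominant:
  fixes z :: "real \<Rightarrow> complex"
  assumes "\<forall>\<^sub>F s in at_top. norm (z s) \<le> 3 / 2 * s"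
  shows "((\<lambda>s. complex_of_real (exp (- (2 * s)) * cosh (norm (z s)))) \<longlongrightarrow> 0) at_top"
    and "((\<lambda>s. of_real (exp (- (2 * s)) * sinh (norm (z s))) * sgn (z s)) \<longlongrightarrow> 0) at_top"
proof -
  have lim: "((\<lambda>s::real. exp (- (s / 2))) \<longlongrightarrow> 0) at_top" by real_asymp
  have le: "cosh r \<le> exp r" "sinh r \<le> exp r" "0 \<le> sinh r" if "0 \<le> r" for r :: real
  proof -
    have "0 < exp r" "0 < exp (- r)" "exp (- r) \<le> exp r" using that by simp_all
    then show "cosh r \<le> exp r" "sinh r \<le> exp r" "0 \<le> sinh r"
      by (simp_all add: cosh_def sinh_def del: exp_gt_zero exp_le_cancel_iff)
  qed
  have ex: "exp (- (2 * s)) * exp r \<le> exp (- (s / 2))" if "r \<le> 3 / 2 * s" for r s :: real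
    using that by (simp add: exp_add[symmetric])
  show "((\<lambda>s. complex_of_real (exp (- (2 * s)) * cosh (norm (z s)))) \<longlongrightarrow> 0) at_top"
  proof (rule Lim_null_comparison[OF _ lim])
    show "\<forall>\<^sub>F s in at_top. norm (complex_of_real (exp (- (2 * s)) * cosh (norm (z s)))) \<le> exp (- (s / 2))"
      using assms
    proof eventually_elim
      case (elim s)
      have "exp (- (2 * s)) * cosh (norm (z s)) \<le> exp (- (2 * s)) * exp (norm (z s))"
        by (intro mult_left_mono le) auto
      also have "\<dots> \<le> exp (- (s / 2))" by (rule ex[OF elim])
      finally show ?case by (simp only: norm_of_real abs_mult abs_exp_cancel cosh_real_abs cosh_real_pos abs_of_pos)
    qed
  qed
  show "((\<lambda>s. of_real (exp (- (2 * s)) * sinh (norm (z s))) * sgn (z s)) \<longlongrightarrow> 0) at_top"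
  proof (rule Lim_null_comparison[OF _ lim])
    show "\<forall>\<^sub>F s in at_top. norm (of_real (exp (- (2 * s)) * sinh (norm (z s))) * sgn (z s)) \<le> exp (- (s / 2))"
      using assms
    proof eventually_elim
      case (elim s)
      have "norm (of_real (exp (- (2 * s)) * sinh (norm (z s))) * sgn (z s)) \<le> exp (- (2 * s)) * sinh (norm (z s)) * 1"
        unfolding norm_mult[of _ "sgn (z s)"] norm_of_real using le(3)[of "norm (z s)"]
        by (intro mult_mono) (auto simp: norm_sgn abs_mult)
      also have "\<dots> \<le> exp (- (2 * s)) * exp (norm (z s))"
        using le(2)[of "norm (z s)"] by (simp add: mult_left_mono)
      also have "\<dots> \<le> exp (- (s / 2))" by (rule ex[OF elim])
      finally show ?case .
    qed
  qed
qed

section \<open>Limits for the original and the boosted rates\<close>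

context
  fixes n j :: nat and p \<kappa> :: real
  assumes j: "3 \<le> j" "2 * j < n" and p: "0 < p" and \<kappa>: "0 < \<kappa>"
begin

abbreviation "base \<equiv> two_mode_rates n j \<kappa>"

text \<open>Adding \<open>s\<close> to the rate of the reflection \<open>b\<close> adds \<open>s\<close> to every transform value: \<open>s\<close> at \<open>\<plusminus> 1\<close> becomes
  \<open>2 s\<close>, whereas the other moduli stay below \<open>3 s / 2\<close>, so only the frequencies \<open>\<plusminus> 1\<close> survive.\<close>

abbreviation "boosted s \<equiv> (\<lambda>x. base s x + (if x = 0 then s else 0))"

text \<open>The total rate is 4 s and the dominant modulus is s, hence the factor n exp (3 s). The
  modes \<plusminus> 1 have limit 1 / 2; the modes \<plusminus> j lag by \<kappa> and keep modulus
  exp (-\<kappa>) / 2. Their phases \<plusminus> \<i> enter only through the sinh part and turn the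
  cosine on the rotations into a sine on the reflections.\<close>

lemma base_tendsto:
  "((\<lambda>s. (real n * exp (3 * s)) powr p *
      (\<Sum>g\<in>carrier (dihedral n). \<bar>walk_prob (dihedral n) (reflection_rates (base s)) 1 g - 1 / real (order (dihedral n))\<bar> powr p))
    \<longlongrightarrow> (\<Sum>x\<in>{0..<int n}. \<bar>cos (2 * pi * of_int x / real n) + exp (- \<kappa>) * cos (2 * pi * real j * of_int x / real n)\<bar> powr p
      + \<bar>cos (2 * pi * of_int x / real n) + exp (- \<kappa>) * sin (2 * pi * real j * of_int x / real n)\<bar> powr p)) at_top"
proof -
  have n: "0 < n" using j by simp
  define a where "a k = (if k = 1 \<or> k = int n - 1 then 1 / 2 else 0) + (if k = int j then of_real (exp (- \<kappa>) / 2) else 0)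
    + (if k = int n - int j then of_real (exp (- \<kappa>) / 2) else (0::complex))" for k
  define c where "c k = (if k = 1 \<or> k = int n - 1 then 1 / 2 else 0) + (if k = int j then \<i> * of_real (exp (- \<kappa>) / 2) else 0)
    + (if k = int n - int j then - \<i> * of_real (exp (- \<kappa>) / 2) else (0::complex))" for k
  have lim0: "((\<lambda>s::real. exp (- s) * cosh s) \<longlongrightarrow> 1 / 2) at_top" "((\<lambda>s::real. exp (- s) * sinh s) \<longlongrightarrow> 1 / 2) at_top"
    using tendsto_exp_cosh_sinh[of 0] by simp_all
  have ev: "\<forall>\<^sub>F s in at_top. \<kappa> < s" by (rule eventually_gt_at_top)
  have evp: "\<forall>\<^sub>F s in at_top. (0::real) < s" by (rule eventually_gt_at_top)
  have lim: "((\<lambda>s. complex_of_real (exp (- s) * cosh (norm (rate_transform n (base s) k)))) \<longlongrightarrow> a k) at_top \<and>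
     ((\<lambda>s. of_real (exp (- s) * sinh (norm (rate_transform n (base s) k))) * sgn (rate_transform n (base s) k)) \<longlongrightarrow> c k) at_top"
    if k: "k \<in> {1..<int n}" for k
  proof -
    have g: "rate_transform n (base s) k = (if k = 1 \<or> k = int n - 1 then of_real s else 0)
       + (if k = int j then \<i> * of_real (s - \<kappa>) else 0) - (if k = int n - int j then \<i> * of_real (s - \<kappa>) else 0)" for s
      using rate_transform_two_mode[OF j, of k] k by auto
    consider "k = 1 \<or> k = int n - 1" | "k = int j" | "k = int n - int j"
      | "k \<noteq> 1" "k \<noteq> int n - 1" "k \<noteq> int j" "k \<noteq> int n - int j" by blast
    then show ?thesis
    proof cases
      case 1
      then have g1: "rate_transform n (base s) k = of_real s" "a k = of_real (1 / 2)" "c k = of_real (1 / 2)" for s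
        using j by (auto simp: g a_def c_def)
      have "\<forall>\<^sub>F s in at_top. complex_of_real (exp (- s) * cosh s) = of_real (exp (- s) * cosh (norm (rate_transform n (base s) k)))"
        "\<forall>\<^sub>F s in at_top. complex_of_real (exp (- s) * sinh s) =
          of_real (exp (- s) * sinh (norm (rate_transform n (base s) k))) * sgn (rate_transform n (base s) k)"
        using evp by (eventually_elim; simp add: g1 sgn_of_real)+
      then show ?thesis
        using tendsto_of_real[OF lim0(1), where 'a = complex] tendsto_of_real[OF lim0(2), where 'a = complex]
        unfolding g1(2,3) by (auto elim: Lim_transform_eventually)
    next
      case 2
      then have nk: "k \<noteq> 1" "k \<noteq> int n - 1" "k \<noteq> int n - int j" using j by auto
      have g1: "rate_transform n (base s) k = \<i> * of_real (s - \<kappa>)" "a k = of_real (exp (- \<kappa>) / 2)" "c k = of_real (exp (- \<kappa>) / 2) * \<i>" for s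
        unfolding g a_def c_def using 2 nk by simp_all
      have s: "norm (\<i> * complex_of_real (s - \<kappa>)) = s - \<kappa>" "sgn (\<i> * complex_of_real (s - \<kappa>)) = \<i>" if "\<kappa> < s" for s
        using that by (simp_all add: norm_mult sgn_mult sgn_of_real del: of_real_diff) (simp add: sgn_div_norm)
      have "\<forall>\<^sub>F s in at_top. complex_of_real (exp (- s) * cosh (s - \<kappa>)) = of_real (exp (- s) * cosh (norm (rate_transform n (base s) k)))"
        "\<forall>\<^sub>F s in at_top. complex_of_real (exp (- s) * sinh (s - \<kappa>)) * \<i> =
          of_real (exp (- s) * sinh (norm (rate_transform n (base s) k))) * sgn (rate_transform n (base s) k)"
        using ev unfolding g1(1) by (auto simp only: s elim!: eventually_mono)
      then show ?thesis
        using tendsto_of_real[OF tendsto_exp_cosh_sinh(1)[of \<kappa>], where 'a = complex]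
          tendsto_mult_right[OF tendsto_of_real[OF tendsto_exp_cosh_sinh(2)[of \<kappa>], where 'a = complex], of \<i>]
        unfolding g1(2,3) by (auto elim: Lim_transform_eventually)
    next
      case 3
      then have nk: "k \<noteq> 1" "k \<noteq> int n - 1" "k \<noteq> int j" using j by auto
      have g1: "rate_transform n (base s) k = - (\<i> * of_real (s - \<kappa>))" "a k = of_real (exp (- \<kappa>) / 2)" "c k = of_real (exp (- \<kappa>) / 2) * - \<i>" for s
        unfolding g a_def c_def using 3 nk by simp_all
      have s: "norm (- (\<i> * complex_of_real (s - \<kappa>))) = s - \<kappa>" "sgn (- (\<i> * complex_of_real (s - \<kappa>))) = - \<i>" if "\<kappa> < s" for s
        using that by (simp_all add: norm_mult sgn_mult sgn_minus sgn_of_real del: of_real_diff) (simp add: sgn_div_norm)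
      have "\<forall>\<^sub>F s in at_top. complex_of_real (exp (- s) * cosh (s - \<kappa>)) = of_real (exp (- s) * cosh (norm (rate_transform n (base s) k)))"
        "\<forall>\<^sub>F s in at_top. complex_of_real (exp (- s) * sinh (s - \<kappa>)) * - \<i> =
          of_real (exp (- s) * sinh (norm (rate_transform n (base s) k))) * sgn (rate_transform n (base s) k)"
        using ev unfolding g1(1) by (auto simp only: s elim!: eventually_mono)
      then show ?thesis
        using tendsto_of_real[OF tendsto_exp_cosh_sinh(1)[of \<kappa>], where 'a = complex]
          tendsto_mult_right[OF tendsto_of_real[OF tendsto_exp_cosh_sinh(2)[of \<kappa>], where 'a = complex], of "- \<i>"]
        unfolding g1(2,3) by (auto elim: Lim_transform_eventually)
    next
      case 4
      then have g1: "rate_transform n (base s) k = 0" "a k = 0" "c k = 0" for s by (auto simp: g a_def c_def)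
      \<comment> \<open>Here cosh 0 = 1 leaves exp (-s), and the sinh part is 0.\<close>
      have "((\<lambda>s::real. exp (- s)) \<longlongrightarrow> 0) at_top" by real_asymp
      from tendsto_of_real[OF this, where 'a = complex] show ?thesis by (simp add: g1)
    qed
  qed
  have B: "sum (base s) {0..<int n} = 4 * s" for s by (rule sum_two_mode[OF j])
  have main: "((\<lambda>s. (real n * exp (sum (base s) {0..<int n} - s)) powr p *
      (\<Sum>g\<in>carrier (dihedral n). \<bar>walk_prob (dihedral n) (reflection_rates (base s)) 1 g - 1 / real (order (dihedral n))\<bar> powr p))
    \<longlongrightarrow> (\<Sum>x\<in>{0..<int n}. \<bar>cos (2 * pi * of_int x / real n) + exp (- \<kappa>) * cos (2 * pi * real j * of_int x / real n)\<bar> powr p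
      + \<bar>cos (2 * pi * of_int x / real n) + exp (- \<kappa>) * sin (2 * pi * real j * of_int x / real n)\<bar> powr p)) at_top"
  proof (rule scaled_lp_sum_tendsto[where a = a and c = c and q = "\<lambda>s. s"])
    show "\<forall>\<^sub>F s in at_top. \<forall>x\<in>{0..<int n}. 0 < base s x"
      using ev by eventually_elim (use n \<kappa> in \<open>auto intro: two_mode_rates_pos\<close>)
    show "((\<lambda>s. exp (- sum (base s) {0..<int n} - s)) \<longlongrightarrow> 0) at_top"
      unfolding B by real_asymp
    fix x
    show "(\<Sum>k\<in>{1..<int n}. chi n k (- x) * a k)
        = of_real (cos (2 * pi * of_int x / real n) + exp (- \<kappa>) * cos (2 * pi * real j * of_int x / real n))"
      unfolding a_def sum_chi_four_modes[OF j] by (simp add: complex_eq_iff Re_chi Im_chi)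
    show "(\<Sum>k\<in>{1..<int n}. chi n k (- x) * c k)
        = of_real (cos (2 * pi * of_int x / real n) + exp (- \<kappa>) * sin (2 * pi * real j * of_int x / real n))"
      unfolding c_def sum_chi_four_modes[OF j] by (simp add: complex_eq_iff Re_chi Im_chi)
  qed (use n p lim in auto)
  have "4 * s - s = 3 * s" for s :: real by simp
  with main show ?thesis by (simp only: B)
qed

text \<open>The total rate 5 s and the dominant modulus 2 s again differ by 3 s, so the normalising
  factor is that of \<open>base_tendsto\<close> and the two limits can be compared.\<close>

lemma boosted_tendsto:
  "((\<lambda>s. (real n * exp (3 * s)) powr p *
      (\<Sum>g\<in>carrier (dihedral n). \<bar>walk_prob (dihedral n) (reflection_rates (boosted s)) 1 g - 1 / real (order (dihedral n))\<bar> powr p))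
    \<longlongrightarrow> (\<Sum>x\<in>{0..<int n}. \<bar>cos (2 * pi * of_int x / real n)\<bar> powr p + \<bar>cos (2 * pi * of_int x / real n)\<bar> powr p)) at_top"
proof -
  have n: "0 < n" using j by simp
  \<comment> \<open>The vanishing modes are written out so that the form fits
    \<open>sum_chi_four_modes\<close>. The surviving transform values are positive reals, so one
    \<open>a\<close> serves both cosets.\<close>
  define a where "a k = (if k = 1 \<or> k = int n - 1 then 1 / 2 else 0) + (if k = int j then 0 else 0)
    + (if k = int n - int j then 0 else (0::complex))" for k
  have ev: "\<forall>\<^sub>F s in at_top. \<kappa> < s" by (rule eventually_gt_at_top)
  have evp: "\<forall>\<^sub>F s in at_top. (0::real) < s" by (rule eventually_gt_at_top)
  have two: "filterlim (\<lambda>s::real. 2 * s) at_top at_top" by real_asymp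
  have lim0: "((\<lambda>s::real. exp (- (2 * s)) * cosh (2 * s)) \<longlongrightarrow> 1 / 2) at_top" "((\<lambda>s::real. exp (- (2 * s)) * sinh (2 * s)) \<longlongrightarrow> 1 / 2) at_top"
    using filterlim_compose[OF tendsto_exp_cosh_sinh(1)[of 0] two] filterlim_compose[OF tendsto_exp_cosh_sinh(2)[of 0] two]
    by simp_all
  have lim: "((\<lambda>s. complex_of_real (exp (- (2 * s)) * cosh (norm (rate_transform n (boosted s) k)))) \<longlongrightarrow> a k) at_top \<and>
     ((\<lambda>s. of_real (exp (- (2 * s)) * sinh (norm (rate_transform n (boosted s) k))) * sgn (rate_transform n (boosted s) k)) \<longlongrightarrow> a k) at_top"
    if k: "k \<in> {1..<int n}" for k
  proof -
    have g: "rate_transform n (boosted s) k = (if k = 1 \<or> k = int n - 1 then of_real s else 0)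
       + (if k = int j then \<i> * of_real (s - \<kappa>) else 0) - (if k = int n - int j then \<i> * of_real (s - \<kappa>) else 0) + of_real s" for s
      using rate_transform_two_mode[OF j, of k] k by (simp add: rate_transform_add_identity[OF n])
    show ?thesis
    proof (cases "k = 1 \<or> k = int n - 1")
      case True
      then have g1: "rate_transform n (boosted s) k = of_real (2 * s)" "a k = of_real (1 / 2)" for s
        using j by (auto simp: g a_def)
      have "\<forall>\<^sub>F s in at_top. complex_of_real (exp (- (2 * s)) * cosh (2 * s)) = of_real (exp (- (2 * s)) * cosh (norm (rate_transform n (boosted s) k)))"
        "\<forall>\<^sub>F s in at_top. complex_of_real (exp (- (2 * s)) * sinh (2 * s)) =
          of_real (exp (- (2 * s)) * sinh (norm (rate_transform n (boosted s) k))) * sgn (rate_transform n (boosted s) k)"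
        using evp by (eventually_elim; simp add: g1(1) sgn_of_real del: of_real_mult)+
      then show ?thesis
        using tendsto_of_real[OF lim0(1), where 'a = complex] tendsto_of_real[OF lim0(2), where 'a = complex]
        unfolding g1(2) by (auto elim: Lim_transform_eventually)
    next
      case False
      then have a0: "a k = 0" by (simp add: a_def)
      have "\<forall>\<^sub>F s in at_top. norm (rate_transform n (boosted s) k) \<le> 3 / 2 * s"
        using ev
      proof eventually_elim
        case (elim s)
        \<comment> \<open>At \<plusminus> j the value is s \<plusminus> \<i> (s - \<kappa>),
          elsewhere s; since 2 \<le> 9 / 4, the modulus is at most 3 s / 2.\<close>
        have "(norm (rate_transform n (boosted s) k))\<^sup>2 \<le> s\<^sup>2 + (s - \<kappa>)\<^sup>2"
          unfolding g cmod_power2 using False j zero_le_power2[of "s - \<kappa>"] by (auto simp: power2_eq_square algebra_simps)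
        also have "\<dots> \<le> s\<^sup>2 + s\<^sup>2" using elim \<kappa> by (intro add_left_mono power_mono) auto
        also have "\<dots> \<le> (3 / 2 * s)\<^sup>2" by (simp add: power2_eq_square)
        finally show ?case by (rule power2_le_imp_le) (use elim \<kappa> in simp)
      qed
      from tendsto_subdominant[OF this] show ?thesis by (simp only: a0)
    qed
  qed
  have B: "sum (boosted s) {0..<int n} = 5 * s" for s
    using sum_two_mode[OF j, of \<kappa> s] n by (simp add: sum.distrib)
  have main: "((\<lambda>s. (real n * exp (sum (boosted s) {0..<int n} - 2 * s)) powr p *
      (\<Sum>g\<in>carrier (dihedral n). \<bar>walk_prob (dihedral n) (reflection_rates (boosted s)) 1 g - 1 / real (order (dihedral n))\<bar> powr p))
    \<longlongrightarrow> (\<Sum>x\<in>{0..<int n}. \<bar>cos (2 * pi * of_int x / real n)\<bar> powr p + \<bar>cos (2 * pi * of_int x / real n)\<bar> powr p)) at_top"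
  proof (rule scaled_lp_sum_tendsto[where a = a and c = a and q = "\<lambda>s. 2 * s"])
    show "\<forall>\<^sub>F s in at_top. \<forall>x\<in>{0..<int n}. 0 < boosted s x"
      using ev by eventually_elim (use n \<kappa> in \<open>auto intro!: add_pos_nonneg two_mode_rates_pos\<close>)
    show "((\<lambda>s. exp (- sum (boosted s) {0..<int n} - 2 * s)) \<longlongrightarrow> 0) at_top"
      unfolding B by real_asymp
    fix x
    show "(\<Sum>k\<in>{1..<int n}. chi n k (- x) * a k) = of_real (cos (2 * pi * of_int x / real n))"
      unfolding a_def sum_chi_four_modes[OF j] by (simp add: complex_eq_iff Re_chi Im_chi)
    then show "(\<Sum>k\<in>{1..<int n}. chi n k (- x) * a k) = of_real (cos (2 * pi * of_int x / real n))" .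
  qed (use n p lim in auto)
  have "5 * s - 2 * s = 3 * s" for s :: real by simp
  with main show ?thesis by (simp only: B)
qed

text \<open>Both sums carry the same positive scaling factor, so a strict inequality between the two
  limits passes to the distances themselves for large s.\<close>

lemma ex_lp_distance_less:
  assumes less: "(\<Sum>x\<in>{0..<int n}. \<bar>cos (2 * pi * of_int x / real n) + exp (- \<kappa>) * cos (2 * pi * real j * of_int x / real n)\<bar> powr p
      + \<bar>cos (2 * pi * of_int x / real n) + exp (- \<kappa>) * sin (2 * pi * real j * of_int x / real n)\<bar> powr p)
    < (\<Sum>x\<in>{0..<int n}. \<bar>cos (2 * pi * of_int x / real n)\<bar> powr p + \<bar>cos (2 * pi * of_int x / real n)\<bar> powr p)"
  shows "\<exists>s>\<kappa>. lp_distance (dihedral n) (reflection_rates (base s)) p 1 < lp_distance (dihedral n) (reflection_rates (boosted s)) p 1"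
proof -
  define D where "D l = (\<Sum>g\<in>carrier (dihedral n). \<bar>walk_prob (dihedral n) (reflection_rates l) 1 g - 1 / real (order (dihedral n))\<bar> powr p)" for l
  obtain m where m: "(\<Sum>x\<in>{0..<int n}. \<bar>cos (2 * pi * of_int x / real n) + exp (- \<kappa>) * cos (2 * pi * real j * of_int x / real n)\<bar> powr p
      + \<bar>cos (2 * pi * of_int x / real n) + exp (- \<kappa>) * sin (2 * pi * real j * of_int x / real n)\<bar> powr p) < m"
    "m < (\<Sum>x\<in>{0..<int n}. \<bar>cos (2 * pi * of_int x / real n)\<bar> powr p + \<bar>cos (2 * pi * of_int x / real n)\<bar> powr p)"
    using dense[OF less] by blast
  have "\<forall>\<^sub>F s in at_top. \<kappa> < s \<and> (real n * exp (3 * s)) powr p * D (base s) < (real n * exp (3 * s)) powr p * D (boosted s)"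
    using order_tendstoD(2)[OF base_tendsto m(1)] order_tendstoD(1)[OF boosted_tendsto m(2)] eventually_gt_at_top[of \<kappa>]
    by eventually_elim (simp add: D_def)
  then obtain s where s: "\<kappa> < s" "(real n * exp (3 * s)) powr p * D (base s) < (real n * exp (3 * s)) powr p * D (boosted s)"
    using eventually_happens' trivial_limit_at_top_linorder by blast
  then have "D (base s) < D (boosted s)" by (simp add: mult_less_cancel_left)
  moreover have "0 \<le> D (base s)" by (simp add: D_def sum_nonneg)
  ultimately have "D (base s) powr (1 / p) < D (boosted s) powr (1 / p)"
    using p by (intro powr_less_mono2) auto
  with s(1) show ?thesis unfolding lp_distance_def D_def by blast
qed

end

section \<open>Choice of j, n, \<eta> and s\<close>

theorem theorem3:
  fixes p :: real
  assumes "1 < p" and "\<nexists>m::int. even m \<and> p = of_int m"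
  shows "\<exists>n::nat. 0 < n \<and> \<not> rate_monotonic (dihedral n) p \<and>
    (\<exists>rate rate'.
       rate_collection (dihedral n) rate \<and> symmetric_rates (dihedral n) rate \<and>
       generating_rates (dihedral n) rate \<and>
       rate_collection (dihedral n) rate' \<and> symmetric_rates (dihedral n) rate' \<and>
       generating_rates (dihedral n) rate' \<and>
       rates_le (dihedral n) rate rate' \<and>
       (\<exists>t\<ge>0. lp_distance (dihedral n) rate p t < lp_distance (dihedral n) rate' p t))"
proof -
  obtain j where j: "3 \<le> j" "cos_coeff p j < 0" using ex_cos_coeff_neg[OF assms] by blast
  obtain n where n: "2 * j < n"
    and neg: "(\<Sum>x<n. sgn (cos (2 * pi * real x / real n)) * \<bar>cos (2 * pi * real x / real n)\<bar> powr (p - 1)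
      * cos (real j * (2 * pi * real x / real n))) < 0"
    using ex_discrete_cos_coeff_neg[OF assms(1) j(2), of "2 * j"] by blast
  from ex_norm_decreasing_perturbation[OF assms(1) neg] obtain \<eta> where \<eta>: "0 < \<eta>" "\<eta> < 1"
    and less: "(\<Sum>x<n. \<bar>cos (2 * pi * real x / real n) + \<eta> * cos (real j * (2 * pi * real x / real n))\<bar> powr p
        + \<bar>cos (2 * pi * real x / real n) + \<eta> * sin (real j * (2 * pi * real x / real n))\<bar> powr p)
    < (\<Sum>x<n. \<bar>cos (2 * pi * real x / real n)\<bar> powr p + \<bar>cos (2 * pi * real x / real n)\<bar> powr p)"
    by blast
  \<comment> \<open>The lag of the modes \<plusminus> j behind \<plusminus> 1 that makes their
    limiting amplitude exp (-\<kappa>) equal to \<eta>.\<close>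
  define \<kappa> where "\<kappa> = - ln \<eta>"
  have \<kappa>: "0 < \<kappa>" "exp (- \<kappa>) = \<eta>" using \<eta> by (simp_all add: \<kappa>_def)
  have n0: "0 < n" and p0: "0 < p" using n assms(1) by simp_all
  have "\<exists>s>\<kappa>. lp_distance (dihedral n) (reflection_rates (two_mode_rates n j \<kappa> s)) p 1
      < lp_distance (dihedral n) (reflection_rates (\<lambda>x. two_mode_rates n j \<kappa> s x + (if x = 0 then s else 0))) p 1"
  proof (rule ex_lp_distance_less[OF j(1) n p0 \<kappa>(1)])
    have 1: "(\<Sum>x\<in>{0..<int n}. \<bar>cos (2 * pi * of_int x / real n) + exp (- \<kappa>) * cos (2 * pi * real j * of_int x / real n)\<bar> powr p
        + \<bar>cos (2 * pi * of_int x / real n) + exp (- \<kappa>) * sin (2 * pi * real j * of_int x / real n)\<bar> powr p)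
      = (\<Sum>x<n. \<bar>cos (2 * pi * real x / real n) + \<eta> * cos (real j * (2 * pi * real x / real n))\<bar> powr p
        + \<bar>cos (2 * pi * real x / real n) + \<eta> * sin (real j * (2 * pi * real x / real n))\<bar> powr p)"
      unfolding \<kappa>(2) by (rule sum.reindex_bij_witness[of _ int nat]) (auto simp: mult_ac)
    have 2: "(\<Sum>x\<in>{0..<int n}. \<bar>cos (2 * pi * of_int x / real n)\<bar> powr p + \<bar>cos (2 * pi * of_int x / real n)\<bar> powr p)
      = (\<Sum>x<n. \<bar>cos (2 * pi * real x / real n)\<bar> powr p + \<bar>cos (2 * pi * real x / real n)\<bar> powr p)"
      by (rule sum.reindex_bij_witness[of _ int nat]) auto
    show "(\<Sum>x\<in>{0..<int n}. \<bar>cos (2 * pi * of_int x / real n) + exp (- \<kappa>) * cos (2 * pi * real j * of_int x / real n)\<bar> powr p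
        + \<bar>cos (2 * pi * of_int x / real n) + exp (- \<kappa>) * sin (2 * pi * real j * of_int x / real n)\<bar> powr p)
      < (\<Sum>x\<in>{0..<int n}. \<bar>cos (2 * pi * of_int x / real n)\<bar> powr p + \<bar>cos (2 * pi * of_int x / real n)\<bar> powr p)"
      unfolding 1 2 by (rule less)
  qed
  then obtain s where s: "\<kappa> < s" and lt: "lp_distance (dihedral n) (reflection_rates (two_mode_rates n j \<kappa> s)) p 1
      < lp_distance (dihedral n) (reflection_rates (\<lambda>x. two_mode_rates n j \<kappa> s x + (if x = 0 then s else 0))) p 1"
    by blast
  let ?l = "two_mode_rates n j \<kappa> s" and ?l' = "\<lambda>x. two_mode_rates n j \<kappa> s x + (if x = 0 then s else 0)"
  have pos: "0 < ?l x" "0 < ?l' x" for x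
    using two_mode_rates_pos[OF n0 \<kappa>(1) s, of j x] s \<kappa>(1) by auto
  have le: "rates_le (dihedral n) (reflection_rates ?l) (reflection_rates ?l')"
    using s \<kappa>(1) by (auto simp: rates_le_def reflection_rates_def)
  note props = rate_collection_reflection[OF n0] symmetric_rates_reflection[OF n0] generating_rates_reflection[OF n0]
  have ex: "\<exists>rate rate'.
       rate_collection (dihedral n) rate \<and> symmetric_rates (dihedral n) rate \<and>
       generating_rates (dihedral n) rate \<and>
       rate_collection (dihedral n) rate' \<and> symmetric_rates (dihedral n) rate' \<and>
       generating_rates (dihedral n) rate' \<and>
       rates_le (dihedral n) rate rate' \<and>
       (\<exists>t\<ge>0. lp_distance (dihedral n) rate p t < lp_distance (dihedral n) rate' p t)"
    by (rule exI[of _ "reflection_rates ?l"], rule exI[of _ "reflection_rates ?l'"],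
        intro conjI props le exI[of _ "1::real"] lt) (use pos in auto)
  then have "\<not> rate_monotonic (dihedral n) p"
    unfolding rate_monotonic_def by (meson not_le)
  with n0 ex show ?thesis by blast
qed

end
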